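(* Let $X$ be a stable, conservative, non-explosive continuous-time Markov chain on a discrete state space $S$ with $Q$-matrix $Q$, let $d$ be a metric on $S$ and $S_0\subseteq S$, and suppose $q_0:=\sup_{x\in S_0}\sum_{y\in N(x)}Q(x,y)<\infty$. Suppose there is a coupling of two copies $(X^{(1)},X^{(2)})$ of $X$ such that, for some $D,\rho,t_0>0$, $$\mathbb E_{x,y}\,d(X^{(1)}(t),X^{(2)}(t))\le De^{-\rho t},\quad0\le t\le t_0,$$ for all $x\in S_0$ and $y\in N(x)$. Suppose $f:S\to\mathbb R$ satisfies $|f(x)-f(x')|\le L\,d(x,x')$ for all $x,x'\in S$. Then for all $x_0\in S_0$, $0<t\le t_0$ and $m>0$, $$\mathbb P_{x_0}\Big[\big\{|f(X(t))-\mathbb E_{x_0}[f(X(t))]|\ge m\big\}\cap A_t\Big]\le2\exp\Big(-\frac{m^2}{2q_0L^2D^2/\rho+4LDm/3}\Big).$$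
   Context: $N(x)=\{y\in S:Q(x,y)>0\}$; $\mathbb E_{x,y}$ denotes expectation for the coupling started at $(X^{(1)}(0),X^{(2)}(0))=(x,y)$; $A_t=\{X(s)\in S_0 \text{ for all } 0\le s<t\}$. *)

theory Defs
  imports "HOL-Probability.Probability"
begin

text \<open>Q-matrix on a countable state space S: off-diagonal entries are nonnegative.
  Stability (-Q x x finite) is automatic since Q is real valued.\<close>
definition Q_matrix :: "'a set \<Rightarrow> ('a \<Rightarrow> 'a \<Rightarrow> real) \<Rightarrow> bool" where
  "Q_matrix S Q \<longleftrightarrow> (\<forall>x\<in>S. \<forall>y\<in>S. x \<noteq> y \<longrightarrow> 0 \<le> Q x y)"

definition conservative :: "'a set \<Rightarrow> ('a \<Rightarrow> 'a \<Rightarrow> real) \<Rightarrow> bool" where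
  "conservative S Q \<longleftrightarrow> (\<forall>x\<in>S. ((\<lambda>y. Q x y) has_sum (- Q x x)) (S - {x}))"

definition nbhd :: "'a set \<Rightarrow> ('a \<Rightarrow> 'a \<Rightarrow> real) \<Rightarrow> 'a \<Rightarrow> 'a set" where
  "nbhd S Q x = {y \<in> S. Q x y > 0}"

definition q0 :: "'a set \<Rightarrow> 'a set \<Rightarrow> ('a \<Rightarrow> 'a \<Rightarrow> real) \<Rightarrow> real" where
  "q0 S S0 Q = (SUP x\<in>S0. (\<Sum>\<^sub>\<infinity>y\<in>nbhd S Q x. Q x y))"

definition metric_on :: "'a set \<Rightarrow> ('a \<Rightarrow> 'a \<Rightarrow> real) \<Rightarrow> bool" where
  "metric_on S d \<longleftrightarrow>
     (\<forall>x\<in>S. \<forall>y\<in>S. 0 \<le> d x y \<and> (d x y = 0 \<longleftrightarrow> x = y) \<and> d x y = d y x) \<and>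
     (\<forall>x\<in>S. \<forall>y\<in>S. \<forall>z\<in>S. d x z \<le> d x y + d y z)"

definition transition_function :: "'a set \<Rightarrow> (real \<Rightarrow> 'a \<Rightarrow> 'a \<Rightarrow> real) \<Rightarrow> bool" where
  "transition_function S P \<longleftrightarrow>
     (\<forall>t\<ge>0. \<forall>x\<in>S. \<forall>y\<in>S. 0 \<le> P t x y) \<and>
     (\<forall>t\<ge>0. \<forall>x\<in>S. ((\<lambda>y. P t x y) has_sum 1) S) \<and>
     (\<forall>x\<in>S. \<forall>y\<in>S. P 0 x y = (if x = y then 1 else 0)) \<and>
     (\<forall>s\<ge>0. \<forall>t\<ge>0. \<forall>x\<in>S. \<forall>y\<in>S. P (s + t) x y = (\<Sum>\<^sub>\<infinity>z\<in>S. P s x z * P t z y)) \<and>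
     (\<forall>x\<in>S. ((\<lambda>t. P t x x) \<longlongrightarrow> 1) (at_right 0))"

definition Q_function :: "'a set \<Rightarrow> ('a \<Rightarrow> 'a \<Rightarrow> real) \<Rightarrow> (real \<Rightarrow> 'a \<Rightarrow> 'a \<Rightarrow> real) \<Rightarrow> bool" where
  "Q_function S Q P \<longleftrightarrow> transition_function S P \<and>
     (\<forall>x\<in>S. \<forall>y\<in>S. ((\<lambda>t. P t x y) has_real_derivative Q x y) (at 0 within {0..}))"

text \<open>A continuous-time Markov chain on S with transition function P started at x,
  realised on the probability space M by the process X, with paths that are
  right-continuous with left limits in the discrete topology of S for all times
  (this encodes non-explosiveness: finitely many jumps on bounded intervals).
  The law is fixed through the finite-dimensional distributions.\<close>
definition markov_chain_from ::
    "'a set \<Rightarrow> (real \<Rightarrow> 'a \<Rightarrow> 'a \<Rightarrow> real) \<Rightarrow> 'w measure \<Rightarrow> (real \<Rightarrow> 'w \<Rightarrow> 'a) \<Rightarrow> 'a \<Rightarrow> bool" where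
  "markov_chain_from S P M X x \<longleftrightarrow>
     prob_space M \<and>
     (\<forall>t\<ge>0. X t \<in> measurable M (count_space UNIV)) \<and>
     (\<forall>\<omega>\<in>space M. \<forall>t\<ge>0. X t \<omega> \<in> S) \<and>
     (\<forall>\<omega>\<in>space M. \<forall>t\<ge>0. \<exists>\<epsilon>>0. \<forall>s. t \<le> s \<and> s < t + \<epsilon> \<longrightarrow> X s \<omega> = X t \<omega>) \<and>
     (\<forall>\<omega>\<in>space M. \<forall>t>0. \<exists>\<epsilon>>0. \<exists>z. \<forall>s. t - \<epsilon> < s \<and> s < t \<longrightarrow> X s \<omega> = z) \<and>
     (\<forall>n (ts :: nat \<Rightarrow> real) (xs :: nat \<Rightarrow> 'a).
        (\<forall>i<n. 0 \<le> ts i \<and> xs i \<in> S) \<and> (\<forall>i. Suc i < n \<longrightarrow> ts i \<le> ts (Suc i)) \<longrightarrow>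
        measure M {\<omega> \<in> space M. \<forall>i<n. X (ts i) \<omega> = xs i} =
          (\<Prod>i<n. P (if i = 0 then ts 0 else ts i - ts (i - 1))
                      (if i = 0 then x else xs (i - 1)) (xs i)))"

end

theory Submission
  imports Defs
begin

text \<open>
  Write \<open>g s x\<close> for the mean of \<open>f (X s)\<close> under the chain started at \<open>x\<close>. By Chapman-Kolmogorov,
  \<open>g (t - s) (X s)\<close> is a martingale, and by the coupling its jumps out of \<open>S0\<close> at time \<open>s\<close> have size at most
  \<open>L * D * exp (- \<rho> * (t - s))\<close>. Hence \<open>exp (\<theta> * g s x + v * (1 - exp (- 2 * \<rho> * s)) / (2 * \<rho>))\<close> is a
  supersolution of the backward equation on \<open>S0\<close>, with \<open>v\<close> of order \<open>\<theta>\<^sup>2\<close>, and the Chernoff bound applies.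

  No continuous-time martingale theory is needed. For \<open>x\<close> ranging over a finite subset of \<open>S0\<close> and bounded \<open>f\<close>,
  the supersolution inequality holds for the time-\<open>h\<close> transition kernel up to a factor \<open>exp (\<epsilon> * h)\<close>, uniformly in
  time, because the kernel is within \<open>o(h)\<close> of its first-order expansion in total variation. Iterating it along the
  grid of mesh \<open>h\<close> and letting \<open>\<epsilon>\<close> tend to 0 gives the bound for the event of staying in that finite set.
  A path visits finitely many states before time \<open>t\<close>, so finite sets exhaust \<open>S0\<close>; unbounded \<open>f\<close> is truncated.
\<close>

section \<open>Truncation and elementary inequalities\<close>

definition truncate :: "nat \<Rightarrow> real \<Rightarrow> real" where
  "truncate k r = max (- real k) (min (real k) r)"

lemma nn_integral_count_space_eq_infsum:
  fixes f :: "'a \<Rightarrow> real"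
  assumes "f summable_on A" "\<And>x. x \<in> A \<Longrightarrow> 0 \<le> f x"
  shows "(\<integral>\<^sup>+x. ennreal (f x) \<partial>count_space A) = ennreal (infsum f A)"
proof -
  have "(\<lambda>x. norm (f x)) summable_on A"
    using assms by (subst summable_on_cong[of A "\<lambda>x. norm (f x)" f]) auto
  then have abs: "Infinite_Set_Sum.abs_summable_on f A"
    by (subst abs_summable_equivalent[symmetric])
  then have "(\<integral>\<^sup>+x. ennreal (f x) \<partial>count_space A) = ennreal (infsetsum f A)"
    unfolding infsetsum_def Infinite_Set_Sum.abs_summable_on_def
    by (intro nn_integral_eq_integral) (auto simp: AE_count_space assms(2))
  with infsetsum_infsum[OF abs] show ?thesis by simp
qed

text \<open>The range up to 3/2 is what the Chernoff step can afford: its parameter satisfies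
  \<open>\<theta> * B \<le> 3/2\<close>, which is the source of the 4/3 in the final bound. The
  quotient \<open>h\<close> of the quadratic by the exponential falls on the negative half-line,
  rises on [0, 1] and falls afterwards, so up to 3/2 it is at least the smaller of its values at 0
  and at 3/2.\<close>

lemma exp_le_quadratic:
  fixes u :: real
  assumes "u \<le> 3/2"
  shows "exp u \<le> 1 + u + u\<^sup>2"
proof -
  define h where "h v = exp (-v) * (1 + v + v\<^sup>2)" for v :: real
  have der: "(h has_real_derivative exp (-v) * (v * (1 - v))) (at v)" for v
    unfolding h_def by (auto intro!: derivative_eq_intros simp: algebra_simps power2_eq_square)
  have h0: "h 0 = 1" by (simp add: h_def)
  \<comment> \<open>19/4 is the value of the quadratic at 3/2. Cutting 3/2 into 30 pieces of length
    1/20 makes the crude second-order bound on each piece accurate enough.\<close>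
  have "exp (3/2 :: real) \<le> 19/4"
  proof -
    have "exp (1/20 :: real) \<le> 1 + 1/20 + (1/20)^2" by (rule exp_bound) auto
    then have "exp (1/20 :: real) ^ 30 \<le> (1 + 1/20 + (1/20)^2) ^ 30" by (intro power_mono) auto
    also have "exp (1/20 :: real) ^ 30 = exp (3/2)" by (simp add: exp_of_nat_mult[symmetric])
    finally show ?thesis by (simp add: power2_eq_square eval_nat_numeral field_simps)
  qed
  then have h32: "1 \<le> h (3/2)"
    by (simp add: h_def exp_minus field_simps power2_eq_square)
  have "1 \<le> h u"
  proof -
    consider "u \<le> 0" | "0 \<le> u" "u \<le> 1" | "1 \<le> u" by linarith
    then show ?thesis
    proof cases
      case 1
      have "h 0 \<le> h u"
        by (rule DERIV_nonpos_imp_nonincreasing[OF 1])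
           (metis der mult_nonneg_nonpos exp_ge_zero mult_nonpos_nonneg diff_ge_0_iff_ge order_trans zero_le_one)
      with h0 show ?thesis by simp
    next
      case 2
      have "h 0 \<le> h u"
      proof (rule DERIV_nonneg_imp_nondecreasing[OF 2(1)])
        fix x assume "0 \<le> x" "x \<le> u"
        with 2 have "0 \<le> exp (-x) * (x * (1 - x))" by simp
        with der show "\<exists>y. (h has_real_derivative y) (at x) \<and> 0 \<le> y" by blast
      qed
      with h0 show ?thesis by simp
    next
      case 3
      have "h (3/2) \<le> h u"
      proof (rule DERIV_nonpos_imp_nonincreasing[OF assms])
        fix x assume "u \<le> x" "x \<le> 3/2"
        with 3 have "exp (-x) * (x * (1 - x)) \<le> 0"
          by (intro mult_nonneg_nonpos) auto
        with der show "\<exists>y. (h has_real_derivative y) (at x) \<and> y \<le> 0" by blast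
      qed
      with h32 show ?thesis by simp
    qed
  qed
  then show ?thesis by (simp add: h_def exp_minus field_simps)
qed

lemma integrable_bounded_pmf:
  fixes p :: "'b pmf" and f :: "'b \<Rightarrow> real"
  assumes "\<And>y. \<bar>f y\<bar> \<le> C"
  shows "integrable (measure_pmf p) f"
  by (rule measure_pmf.integrable_const_bound[where B=C]) (auto simp: assms)

subsection \<open>Transition kernels and their generator\<close>

locale Q_process =
  fixes S :: "'a set" and Q :: "'a \<Rightarrow> 'a \<Rightarrow> real" and P :: "real \<Rightarrow> 'a \<Rightarrow> 'a \<Rightarrow> real"
  assumes countable_S: "countable S" and Q_matrix: "Q_matrix S Q"
    and conservative: "conservative S Q" and Q_function: "Q_function S Q P"
begin

lemma P_nonneg: "0 \<le> t \<Longrightarrow> x \<in> S \<Longrightarrow> y \<in> S \<Longrightarrow> 0 \<le> P t x y"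
  and P_has_sum: "0 \<le> t \<Longrightarrow> x \<in> S \<Longrightarrow> ((\<lambda>y. P t x y) has_sum 1) S"
  and P_0: "x \<in> S \<Longrightarrow> y \<in> S \<Longrightarrow> P 0 x y = (if x = y then 1 else 0)"
  and Chapman_Kolmogorov: "0 \<le> s \<Longrightarrow> 0 \<le> t \<Longrightarrow> x \<in> S \<Longrightarrow> y \<in> S \<Longrightarrow>
        P (s + t) x y = (\<Sum>\<^sub>\<infinity>z\<in>S. P s x z * P t z y)"
  and P_deriv: "x \<in> S \<Longrightarrow> y \<in> S \<Longrightarrow>
        ((\<lambda>t. P t x y) has_real_derivative Q x y) (at 0 within {0..})"
  using Q_function by (auto simp: Q_function_def transition_function_def)

lemma Q_nonneg: "x \<in> S \<Longrightarrow> y \<in> S \<Longrightarrow> x \<noteq> y \<Longrightarrow> 0 \<le> Q x y"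
  using Q_matrix by (auto simp: Q_matrix_def)

lemma Q_has_sum: "x \<in> S \<Longrightarrow> ((\<lambda>y. Q x y) has_sum (- Q x x)) (S - {x})"
  using conservative by (auto simp: conservative_def)

lemma Q_diag_nonpos: "x \<in> S \<Longrightarrow> Q x x \<le> 0"
  using has_sum_nonneg[OF Q_has_sum] Q_nonneg by fastforce

lemma nbhd_subset: "x \<in> S \<Longrightarrow> nbhd S Q x \<subseteq> S - {x}"
  using Q_diag_nonpos by (fastforce simp: nbhd_def)

text \<open>Extending the row \<open>P t x\<close> by zero off \<open>S\<close> gives a
  \<open>pmf\<close> on the whole type, so that Chapman-Kolmogorov becomes a monadic bind and
  expectations are available.\<close>

definition kernel :: "real \<Rightarrow> 'a \<Rightarrow> 'a pmf" where
  "kernel t x = embed_pmf (\<lambda>y. if y \<in> S then P t x y else 0)"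

lemma pmf_kernel:
  assumes "0 \<le> t" "x \<in> S"
  shows "pmf (kernel t x) y = (if y \<in> S then P t x y else 0)"
  unfolding kernel_def
proof (rule pmf_embed_pmf)
  show "0 \<le> (if y \<in> S then P t x y else 0)" for y
    using P_nonneg assms by auto
  have "(\<integral>\<^sup>+y. ennreal (if y \<in> S then P t x y else 0) \<partial>count_space UNIV) =
        (\<integral>\<^sup>+y. ennreal (P t x y) \<partial>count_space S)"
    by (subst nn_integral_count_space_indicator[of S])
       (auto intro!: nn_integral_cong split: split_indicator)
  also have "\<dots> = 1"
    using P_has_sum[OF assms] P_nonneg[OF assms]
    by (subst nn_integral_count_space_eq_infsum) (auto simp: has_sum_iff)
  finally show "(\<integral>\<^sup>+y. ennreal (if y \<in> S then P t x y else 0) \<partial>count_space UNIV) = 1" .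
qed

lemma nn_integral_kernel:
  assumes "0 \<le> t" "x \<in> S"
  shows "(\<integral>\<^sup>+y. u y \<partial>kernel t x) = (\<integral>\<^sup>+y. ennreal (P t x y) * u y \<partial>count_space S)"
  unfolding nn_integral_measure_pmf
  by (subst nn_integral_count_space_indicator[of S])
     (auto intro!: nn_integral_cong simp: pmf_kernel[OF assms] split: split_indicator)

lemma kernel_0: "x \<in> S \<Longrightarrow> kernel 0 x = return_pmf x"
  by (rule pmf_eqI) (auto simp: pmf_kernel P_0)

lemma kernel_add:
  assumes "0 \<le> s" "0 \<le> t" "x \<in> S"
  shows "kernel (s + t) x = bind_pmf (kernel s x) (kernel t)"
proof (rule pmf_eqI)
  fix y
  have "ennreal (pmf (bind_pmf (kernel s x) (kernel t)) y) =
        (\<integral>\<^sup>+z. ennreal (P s x z) * ennreal (if y \<in> S then P t z y else 0) \<partial>count_space S)"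
    using assms by (auto simp: ennreal_pmf_bind nn_integral_kernel pmf_kernel intro!: nn_integral_cong)
  also have "\<dots> = ennreal (if y \<in> S then P (s + t) x y else 0)"
  proof (cases "y \<in> S")
    case True
    have le1: "P t z y \<le> 1" if "z \<in> S" for z
      using pmf_le_1[of "kernel t z" y] that assms True by (simp add: pmf_kernel)
    have "(\<lambda>z. P s x z * P t z y) summable_on S"
    proof (rule summable_on_comparison_test)
      show "P s x summable_on S"
        using P_has_sum assms by (auto simp: has_sum_iff)
    qed (use assms True P_nonneg le1 in \<open>auto intro!: mult_left_le\<close>)
    then have "(\<integral>\<^sup>+z. ennreal (P s x z * P t z y) \<partial>count_space S) = ennreal (P (s + t) x y)"
      using assms True P_nonneg
      by (subst nn_integral_count_space_eq_infsum) (auto simp: Chapman_Kolmogorov)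
    then show ?thesis
      using True assms P_nonneg by (simp add: ennreal_mult'' cong: nn_integral_cong_simp)
  qed simp
  finally show "pmf (kernel (s + t) x) y = pmf (bind_pmf (kernel s x) (kernel t)) y"
    using assms P_nonneg by (subst (asm) ennreal_inj) (auto simp: pmf_kernel)
qed

text \<open>The transition semigroup acting on \<open>f\<close>, that is, the function
  \<open>g\<close> of the overview.\<close>

definition transition_op :: "('a \<Rightarrow> real) \<Rightarrow> real \<Rightarrow> 'a \<Rightarrow> real" where
  "transition_op f t x = measure_pmf.expectation (kernel t x) f"

lemma abs_transition_op_le:
  assumes "\<And>y. \<bar>f y\<bar> \<le> C"
  shows "\<bar>transition_op f t x\<bar> \<le> C"
proof -
  have "\<bar>transition_op f t x\<bar> \<le> measure_pmf.expectation (kernel t x) (\<lambda>y. \<bar>f y\<bar>)"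
    unfolding transition_op_def by (rule integral_abs_bound)
  also have "\<dots> \<le> C"
    by (rule measure_pmf.integral_le_const) (auto intro!: integrable_bounded_pmf[where C=C] simp: assms)
  finally show ?thesis .
qed

text \<open>The semigroup law is the analytic form of the martingale property of
  \<open>g (t - s) (X s)\<close>.\<close>

lemma transition_op_add:
  assumes f: "\<And>y. \<bar>f y\<bar> \<le> C" and "0 \<le> s" "0 \<le> t" "x \<in> S"
  shows "transition_op f (s + t) x = measure_pmf.expectation (kernel s x) (transition_op f t)"
  unfolding transition_op_def kernel_add[OF assms(2-)] measure_pmf_bind
  by (subst integral_bind[where K="count_space UNIV" and B=C and B'=1])
     (auto simp: f measure_pmf.emeasure_space_1 measure_pmf_in_subprob_algebra)


text \<open>One threshold for \<open>h\<close> serves all \<open>\<phi>\<close> bounded by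
  \<open>C\<close>; this is what makes the later estimates uniform in time. By conservativeness a
  finite \<open>F\<close> carries almost all of the jump rate out of \<open>x\<close>.
  Differentiability at 0 is used only at the finitely many states of \<open>insert x F\<close>; the
  mass elsewhere is controlled by taking the complement.\<close>

lemma generator_approx:
  assumes x: "x \<in> S" and \<epsilon>: "0 < \<epsilon>"
  obtains F where "finite F" "F \<subseteq> S - {x}"
    "\<forall>\<^sub>F h in at_right 0. \<forall>\<phi> C. (\<forall>y. \<bar>\<phi> y\<bar> \<le> C) \<longrightarrow>
       \<bar>measure_pmf.expectation (kernel h x) \<phi> - \<phi> x - h * (\<Sum>z\<in>F. Q x z * (\<phi> z - \<phi> x))\<bar>
         \<le> \<epsilon> * h * C"
proof -
  \<comment> \<open>The states of \<open>F\<close> will cost \<open>2 * \<delta>\<close> and the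
    tail \<open>4 * \<delta>\<close>, each times \<open>h * C\<close>, so one eighth of \<epsilon>
    suffices.\<close>
  define \<delta> where "\<delta> = \<epsilon> / 8"
  have \<delta>: "0 < \<delta>" using \<epsilon> by (simp add: \<delta>_def)
  obtain F where F: "finite F" "F \<subseteq> S - {x}" and sumF: "dist (sum (Q x) F) (- Q x x) \<le> \<delta>"
    using has_sum_finite_approximation[OF Q_has_sum[OF x] \<delta>] by auto
  \<comment> \<open>Shares \<delta> equally among the \<open>card F + 1\<close> states of
    \<open>insert x F\<close>.\<close>
  define \<eta> where "\<eta> = \<delta> / (real (card F) + 1)"
  have \<eta>: "0 < \<eta>"
    using \<delta> by (simp add: \<eta>_def add_nonneg_pos)
  have "(real (card F) + 1) * \<eta> = \<delta>"
    using of_nat_0_le_iff[of "card F", where 'a=real] by (simp add: \<eta>_def del: of_nat_0_le_iff)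
  then have card_\<eta>: "real (card F) * \<eta> + \<eta> = \<delta>"
    by (simp add: distrib_right)
  have ev1: "\<forall>\<^sub>F h in at_right 0. \<bar>(P h x y - P 0 x y) / h - Q x y\<bar> < \<eta>" if "y \<in> S" for y
  proof -
    have "((\<lambda>h. (P h x y - P 0 x y) / (h - 0)) \<longlongrightarrow> Q x y) (at 0 within {0..})"
      using P_deriv[OF x that] by (simp add: has_field_derivative_iff)
    then have "((\<lambda>h. (P h x y - P 0 x y) / h) \<longlongrightarrow> Q x y) (at_right 0)"
      by (auto intro: tendsto_within_subset)
    from tendstoD[OF this \<eta>] show ?thesis by (simp add: dist_real_def)
  qed
  have "\<forall>\<^sub>F h in at_right 0. \<forall>y\<in>insert x F. \<bar>(P h x y - P 0 x y) / h - Q x y\<bar> < \<eta>"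
    using F x by (intro eventually_ball_finite ballI ev1) auto
  moreover have "\<forall>\<^sub>F h in at_right 0. (0::real) < h"
    by (rule eventually_at_right_less)
  ultimately have "\<forall>\<^sub>F h in at_right 0. \<forall>\<phi> C. (\<forall>y. \<bar>\<phi> y\<bar> \<le> C) \<longrightarrow>
      \<bar>measure_pmf.expectation (kernel h x) \<phi> - \<phi> x - h * (\<Sum>z\<in>F. Q x z * (\<phi> z - \<phi> x))\<bar>
        \<le> \<epsilon> * h * C"
  proof (eventually_elim, intro allI impI)
    fix h C :: real and \<phi> :: "'a \<Rightarrow> real"
    assume near: "\<forall>y\<in>insert x F. \<bar>(P h x y - P 0 x y) / h - Q x y\<bar> < \<eta>"
      and h: "0 < h" and "\<forall>y. \<bar>\<phi> y\<bar> \<le> C"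
    then have \<phi>: "\<bar>\<phi> y\<bar> \<le> C" for y by blast
    let ?p = "kernel h x" and ?E = "measure_pmf.expectation (kernel h x)"
    have C: "0 \<le> C" using \<phi>[of x] by linarith
    have xF: "x \<notin> F" using F by auto
    have pmf_in: "pmf ?p y = P h x y" if "y \<in> insert x F" for y
      using that F x h by (auto simp: pmf_kernel)
    have diff: "\<bar>\<phi> y - \<phi> x\<bar> \<le> 2 * C" for y
      using \<phi>[of y] \<phi>[of x] by linarith
    have nearF: "\<bar>P h x z - h * Q x z\<bar> \<le> h * \<eta>" if "z \<in> F" for z
    proof -
      have "P 0 x z = 0" using that F x xF by (subst P_0) auto
      then show ?thesis
        using near[rule_format, of z] that h by (auto simp: field_simps abs_le_iff abs_less_iff)
    qed
    have nearx: "1 - P h x x \<le> h * (- Q x x + \<eta>)"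
      using near[rule_format, of x] x h by (auto simp: P_0 field_simps abs_le_iff abs_less_iff)
    \<comment> \<open>Of the resulting \<open>2 * \<delta>\<close>, one \<delta> is the rate that
      \<open>F\<close> misses and the other collects the derivative errors at the states of
      \<open>insert x F\<close>.\<close>
    have "measure_pmf.prob ?p (- insert x F) = 1 - (P h x x + (\<Sum>z\<in>F. P h x z))"
      using F(1) xF measure_pmf.prob_compl[of "insert x F" ?p]
      by (simp add: Compl_eq_Diff_UNIV measure_measure_pmf_finite pmf_in cong: sum.cong)
    also have "\<dots> \<le> h * (- Q x x + \<eta>) - (\<Sum>z\<in>F. h * Q x z - h * \<eta>)"
      using nearx sum_mono[of F "\<lambda>z. h * Q x z - h * \<eta>" "\<lambda>z. P h x z"] nearF
      by (fastforce simp: abs_le_iff)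
    also have "\<dots> = h * (- Q x x - sum (Q x) F + (real (card F) * \<eta> + \<eta>))"
      by (simp add: sum_subtractf sum_distrib_left algebra_simps)
    also have "\<dots> \<le> h * (2 * \<delta>)"
      using sumF h by (intro mult_left_mono) (auto simp: card_\<eta> dist_real_def)
    finally have tail: "measure_pmf.prob ?p (- insert x F) \<le> h * (2 * \<delta>)" .

    have int: "integrable ?p (\<lambda>y. indicator A y * (\<phi> y - \<phi> x))" for A :: "'a set"
      using diff C by (intro integrable_bounded_pmf[where C="2 * C"]) (auto split: split_indicator)
    have "?E \<phi> - \<phi> x = ?E (\<lambda>y. \<phi> y - \<phi> x)"
      by (subst Bochner_Integration.integral_diff)
         (auto intro: integrable_bounded_pmf[OF \<phi>])
    also have "\<dots> = ?E (\<lambda>y. indicator F y * (\<phi> y - \<phi> x) + indicator (- insert x F) y * (\<phi> y - \<phi> x))"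
      using xF by (intro Bochner_Integration.integral_cong) (auto split: split_indicator)
    also have "\<dots> = ?E (\<lambda>y. indicator F y * (\<phi> y - \<phi> x)) + ?E (\<lambda>y. indicator (- insert x F) y * (\<phi> y - \<phi> x))"
      by (rule Bochner_Integration.integral_add[OF int int])
    also have "?E (\<lambda>y. indicator F y * (\<phi> y - \<phi> x)) = (\<Sum>z\<in>F. P h x z * (\<phi> z - \<phi> x))"
      using F(1) by (subst integral_measure_pmf[of F]) (auto simp: pmf_in indicator_eq_0_iff intro!: sum.cong)
    finally have split: "?E \<phi> - \<phi> x - h * (\<Sum>z\<in>F. Q x z * (\<phi> z - \<phi> x)) =
        (\<Sum>z\<in>F. (P h x z - h * Q x z) * (\<phi> z - \<phi> x)) + ?E (\<lambda>y. indicator (- insert x F) y * (\<phi> y - \<phi> x))"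
      by (simp add: sum_subtractf sum.distrib sum_distrib_left algebra_simps)
    have "\<bar>\<Sum>z\<in>F. (P h x z - h * Q x z) * (\<phi> z - \<phi> x)\<bar> \<le> (\<Sum>z\<in>F. (h * \<eta>) * (2 * C))"
      using nearF diff h \<eta>
      by (intro order_trans[OF sum_abs] sum_mono) (auto simp: abs_mult intro!: mult_mono)
    also have "\<dots> = (real (card F) * \<eta>) * (2 * C) * h" by simp
    also have "\<dots> \<le> \<delta> * (2 * C) * h"
      using C h \<eta> card_\<eta> by (intro mult_right_mono) auto
    finally have err1: "\<bar>\<Sum>z\<in>F. (P h x z - h * Q x z) * (\<phi> z - \<phi> x)\<bar> \<le> \<delta> * (2 * C) * h" .
    have "\<bar>?E (\<lambda>y. indicator (- insert x F) y * (\<phi> y - \<phi> x))\<bar>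
        \<le> ?E (\<lambda>y. indicator (- insert x F) y * (2 * C))"
    proof (rule order_trans[OF integral_abs_bound integral_mono])
      show "integrable ?p (\<lambda>y. \<bar>indicator (- insert x F) y * (\<phi> y - \<phi> x)\<bar>)"
        using int by (rule integrable_abs)
      show "integrable ?p (\<lambda>y. indicator (- insert x F) y * (2 * C))"
        using C by (intro integrable_bounded_pmf[where C="2 * C"]) (auto split: split_indicator)
    qed (use diff C in \<open>auto split: split_indicator\<close>)
    also have "\<dots> = measure_pmf.prob ?p (- insert x F) * (2 * C)" by simp
    also have "\<dots> \<le> h * (2 * \<delta>) * (2 * C)"
      using tail C by (intro mult_right_mono) auto
    finally have err2: "\<bar>?E (\<lambda>y. indicator (- insert x F) y * (\<phi> y - \<phi> x))\<bar> \<le> h * (2 * \<delta>) * (2 * C)" .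
    have "\<bar>?E \<phi> - \<phi> x - h * (\<Sum>z\<in>F. Q x z * (\<phi> z - \<phi> x))\<bar> \<le> \<delta> * (2 * C) * h + h * (2 * \<delta>) * (2 * C)"
      unfolding split using err1 err2 by linarith
    also have "\<dots> \<le> \<epsilon> * h * C"
      using C h \<delta> by (simp add: \<delta>_def field_simps)
    finally show "\<bar>?E \<phi> - \<phi> x - h * (\<Sum>z\<in>F. Q x z * (\<phi> z - \<phi> x))\<bar> \<le> \<epsilon> * h * C" .
  qed
  with F show thesis by (rule that)
qed


section \<open>The exponential supersolution\<close>

lemma sum_rates_le:
  assumes "x \<in> S" "finite F" "F \<subseteq> S - {x}"
  shows "(\<Sum>z\<in>F. Q x z) \<le> (\<Sum>\<^sub>\<infinity>y\<in>nbhd S Q x. Q x y)"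
proof -
  have "(\<Sum>z\<in>F. Q x z) = (\<Sum>z\<in>F \<inter> nbhd S Q x. Q x z)"
    using assms Q_nonneg by (intro sum.mono_neutral_right) (fastforce simp: nbhd_def)+
  also have "\<dots> \<le> (\<Sum>\<^sub>\<infinity>y\<in>nbhd S Q x. Q x y)"
  proof (rule finite_sum_le_infsum)
    have "Q x summable_on S - {x}"
      using Q_has_sum[OF assms(1)] by (auto simp: has_sum_iff)
    then show "Q x summable_on nbhd S Q x"
      by (rule summable_on_subset) (rule nbhd_subset[OF assms(1)])
  qed (use assms in \<open>auto simp: nbhd_def\<close>)
  finally show ?thesis .
qed

text \<open>Here \<open>s\<close> is the time that remains. The second term of the exponent is the
  integral of \<open>v * exp (- 2 * \<rho> * r)\<close> over r from 0 to \<open>s\<close>, a bound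
  for the variance still to be accumulated. It vanishes at \<open>s = 0\<close> and stays below
  \<open>v / (2 * \<rho>)\<close>.\<close>

definition potential :: "('a \<Rightarrow> real) \<Rightarrow> real \<Rightarrow> real \<Rightarrow> real \<Rightarrow> real \<Rightarrow> 'a \<Rightarrow> real" where
  "potential f \<theta> \<rho> v s y = exp (\<theta> * transition_op f s y + v * (1 - exp (- 2 * \<rho> * s)) / (2 * \<rho>))"

text \<open>Neither bound depends on \<open>s\<close> or \<open>y\<close>. The upper one lets
  \<open>generator_approx\<close> be applied uniformly in \<open>s\<close>; the lower one turns its
  additive error into a multiplicative one.\<close>

lemma potential_bounds:
  assumes f: "\<And>y. \<bar>f y\<bar> \<le> C" and "0 \<le> \<theta>" "0 < \<rho>" "0 \<le> v" "0 \<le> s"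
  shows "exp (- \<theta> * C) \<le> potential f \<theta> \<rho> v s y"
    and "potential f \<theta> \<rho> v s y \<le> exp (\<theta> * C + v / (2 * \<rho>))"
proof -
  have g: "\<bar>transition_op f s y\<bar> \<le> C"
    by (rule abs_transition_op_le[OF f])
  have "\<theta> * transition_op f s y \<le> \<theta> * C" "\<theta> * (- C) \<le> \<theta> * transition_op f s y"
    using g assms by (intro mult_left_mono; simp add: abs_le_iff)+
  moreover have "0 \<le> v * (1 - exp (- 2 * \<rho> * s)) / (2 * \<rho>)"
    "v * (1 - exp (- 2 * \<rho> * s)) / (2 * \<rho>) \<le> v / (2 * \<rho>)"
    using assms by (auto intro!: divide_right_mono mult_left_le)
  ultimately show "exp (- \<theta> * C) \<le> potential f \<theta> \<rho> v s y"
    and "potential f \<theta> \<rho> v s y \<le> exp (\<theta> * C + v / (2 * \<rho>))"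
    by (auto simp: potential_def)
qed

text \<open>The generator acts on \<open>exp (\<theta> * g)\<close> through the jump factors
  \<open>exp u - 1\<close>, with \<open>u\<close> the increment of \<open>\<theta> * g\<close>.
  Bounding these by \<open>u + u^2\<close>, the linear part is the time derivative of
  \<open>\<theta> * g\<close>, and the squares sum to at most
  \<open>v * exp (- 2 * \<rho> * s)\<close>, the time derivative of the correction term. What
  remains is of order o(h) and is paid for by \<open>exp (\<epsilon> * h)\<close>.\<close>

lemma potential_one_step:
  assumes f: "\<And>y. \<bar>f y\<bar> \<le> C" and x: "x \<in> S" and \<rho>: "0 < \<rho>"
    and \<theta>: "0 \<le> \<theta>" "\<theta> * B \<le> 3/2" and B: "0 \<le> B"
    and rate: "(\<Sum>\<^sub>\<infinity>y\<in>nbhd S Q x. Q x y) \<le> q"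
    and contr: "\<And>z s. z \<in> nbhd S Q x \<Longrightarrow> 0 \<le> s \<Longrightarrow> s \<le> T \<Longrightarrow>
      \<bar>transition_op f s z - transition_op f s x\<bar> \<le> B * exp (- \<rho> * s)"
    and v: "v = q * (\<theta> * B)\<^sup>2"
    and \<epsilon>: "0 < \<epsilon>"
  shows "\<forall>\<^sub>F h in at_right 0. \<forall>s. 0 \<le> s \<and> s \<le> T \<longrightarrow>
    measure_pmf.expectation (kernel h x) (potential f \<theta> \<rho> v s)
      \<le> potential f \<theta> \<rho> v (s + h) x * exp (\<epsilon> * h)"
proof -
  have C: "0 \<le> C" using f[of x] by linarith
  have "0 \<le> q" using rate sum_rates_le[OF x, of "{}"] by simp
  then have v0: "0 \<le> v" by (simp add: v)
  \<comment> \<open>The ratio of the upper to the lower bound in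
    \<open>potential_bounds\<close>.\<close>
  define K where "K = exp (2 * \<theta> * C + v / (2 * \<rho>))"
  have K: "0 < K" by (simp add: K_def)
  \<comment> \<open>The generator is approximated twice, for the potential with relative cost
    \<open>K\<close> and for \<open>g\<close> with cost \<open>\<theta> * C\<close> in the exponent.
    Together they may use half of \<epsilon>; the other half is kept for the second-order error of
    the correction term.\<close>
  define \<epsilon>1 where "\<epsilon>1 = \<epsilon> / 2 / (K + \<theta> * C)"
  have KC: "0 < K + \<theta> * C" using K \<theta> C by (simp add: add_pos_nonneg)
  have \<epsilon>1: "0 < \<epsilon>1" "\<epsilon>1 * (K + \<theta> * C) = \<epsilon> / 2"
    using \<epsilon> KC nonzero_divide_eq_eq[of "K + \<theta> * C" "\<epsilon> / 2" \<epsilon>1] by (auto simp: \<epsilon>1_def)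
  obtain F where F: "finite F" "F \<subseteq> S - {x}"
    and gen: "\<forall>\<^sub>F h in at_right 0. \<forall>\<phi> C. (\<forall>y. \<bar>\<phi> y\<bar> \<le> C) \<longrightarrow>
       \<bar>measure_pmf.expectation (kernel h x) \<phi> - \<phi> x - h * (\<Sum>z\<in>F. Q x z * (\<phi> z - \<phi> x))\<bar>
         \<le> \<epsilon>1 * h * C"
    by (rule generator_approx[OF x \<epsilon>1(1)])
  have v\<rho>: "0 < 4 * v * \<rho> + 1" using v0 \<rho> by (simp add: add_nonneg_pos)
  \<comment> \<open>Small enough that the second-order remainder
    \<open>v * (2 * \<rho>) * h * h\<close> is at most \<open>\<epsilon> / 2 * h\<close>. The added
    1 keeps the denominator positive when \<open>v = 0\<close>.\<close>
  have "\<forall>\<^sub>F h in at_right 0. h < \<epsilon> / (4 * v * \<rho> + 1)"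
    using \<epsilon> v\<rho> by (intro order_tendstoD(2)[OF tendsto_ident_at]) auto
  moreover have "\<forall>\<^sub>F h in at_right 0. (0::real) < h"
    by (rule eventually_at_right_less)
  ultimately show ?thesis using gen
  proof (eventually_elim, intro allI impI)
    fix h s :: real
    assume h_less: "h < \<epsilon> / (4 * v * \<rho> + 1)" and h: "0 < h" and "0 \<le> s \<and> s \<le> T"
      and "\<forall>\<phi> C. (\<forall>y. \<bar>\<phi> y\<bar> \<le> C) \<longrightarrow>
       \<bar>measure_pmf.expectation (kernel h x) \<phi> - \<phi> x - h * (\<Sum>z\<in>F. Q x z * (\<phi> z - \<phi> x))\<bar>
         \<le> \<epsilon>1 * h * C"
    then have s: "0 \<le> s" "s \<le> T"
      and gen: "\<And>\<phi> C. (\<And>y. \<bar>\<phi> y\<bar> \<le> C) \<Longrightarrow>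
       \<bar>measure_pmf.expectation (kernel h x) \<phi> - \<phi> x - h * (\<Sum>z\<in>F. Q x z * (\<phi> z - \<phi> x))\<bar>
         \<le> \<epsilon>1 * h * C"
      by auto
    let ?G = "potential f \<theta> \<rho> v" and ?g = "transition_op f"
    have "h * (4 * v * \<rho> + 1) \<le> \<epsilon>"
      using h_less v\<rho> by (simp add: pos_less_divide_eq)
    then have hv: "v * (2 * \<rho>) * h \<le> \<epsilon> / 2"
      using h by (simp add: algebra_simps)
    \<comment> \<open>The time derivative of the exponent of the potential, with the generator cut
      down to \<open>F\<close>.\<close>
    define Y where "Y = \<theta> * (\<Sum>z\<in>F. Q x z * (?g s z - ?g s x)) + v * exp (- 2 * \<rho> * s)"
    have Gpos: "0 < ?G s x" by (simp add: potential_def)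
    have rat: "?G s z = ?G s x * exp (\<theta> * (?g s z - ?g s x))" for z
      by (simp add: potential_def exp_add[symmetric] algebra_simps)
    have jump: "Q x z * (exp (\<theta> * (?g s z - ?g s x)) - 1)
        \<le> \<theta> * (Q x z * (?g s z - ?g s x)) + Q x z * ((\<theta> * B)\<^sup>2 * exp (- 2 * \<rho> * s))" if "z \<in> F" for z
    \<comment> \<open>The contraction estimate covers neighbours of \<open>x\<close> only; any other
      member of \<open>F\<close> has rate zero.\<close>
    proof (cases "z \<in> nbhd S Q x")
      case True
      let ?u = "\<theta> * (?g s z - ?g s x)"
      have "\<bar>?u\<bar> \<le> \<theta> * (B * exp (- \<rho> * s))"
        using contr[OF True s] \<theta> by (simp add: abs_mult mult_left_mono)
      then have u: "\<bar>?u\<bar> \<le> \<theta> * B * exp (- \<rho> * s)" by (simp add: mult.assoc)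
      \<comment> \<open>Brings \<open>?u\<close> into the range of \<open>exp_le_quadratic\<close>,
        while the sharper bound with \<open>exp (- \<rho> * s)\<close> is kept for its
        square.\<close>
      also have "\<dots> \<le> \<theta> * B"
        using \<theta> B \<rho> s by (intro mult_left_le) auto
      finally have "exp ?u \<le> 1 + ?u + ?u\<^sup>2"
        using \<theta> by (intro exp_le_quadratic) auto
      moreover have "?u\<^sup>2 \<le> (\<theta> * B * exp (- \<rho> * s))\<^sup>2"
        using u by (metis abs_le_square_iff abs_of_nonneg abs_ge_zero order_trans)
      moreover have "(\<theta> * B * exp (- \<rho> * s))\<^sup>2 = (\<theta> * B)\<^sup>2 * exp (- 2 * \<rho> * s)"
        by (simp add: power_mult_distrib exp_double[symmetric])
      ultimately have "exp ?u - 1 \<le> ?u + (\<theta> * B)\<^sup>2 * exp (- 2 * \<rho> * s)" by linarith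
      then have "Q x z * (exp ?u - 1) \<le> Q x z * (?u + (\<theta> * B)\<^sup>2 * exp (- 2 * \<rho> * s))"
        using True by (intro mult_left_mono) (auto simp: nbhd_def)
      then show ?thesis by (simp add: algebra_simps)
    next
      case False
      then have "Q x z = 0" using Q_nonneg[OF x, of z] that F by (force simp: nbhd_def)
      then show ?thesis by simp
    qed
    have "(\<Sum>z\<in>F. Q x z * (exp (\<theta> * (?g s z - ?g s x)) - 1))
        \<le> (\<Sum>z\<in>F. \<theta> * (Q x z * (?g s z - ?g s x)) + Q x z * ((\<theta> * B)\<^sup>2 * exp (- 2 * \<rho> * s)))"
      by (rule sum_mono) (rule jump)
    also have "\<dots> = \<theta> * (\<Sum>z\<in>F. Q x z * (?g s z - ?g s x)) + (\<Sum>z\<in>F. Q x z) * ((\<theta> * B)\<^sup>2 * exp (- 2 * \<rho> * s))"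
      by (simp add: sum.distrib sum_distrib_left sum_distrib_right)
    also have "\<dots> \<le> \<theta> * (\<Sum>z\<in>F. Q x z * (?g s z - ?g s x)) + q * ((\<theta> * B)\<^sup>2 * exp (- 2 * \<rho> * s))"
      using sum_rates_le[OF x F] rate by (intro add_left_mono mult_right_mono) auto
    finally have jumps: "(\<Sum>z\<in>F. Q x z * (exp (\<theta> * (?g s z - ?g s x)) - 1)) \<le> Y"
      by (simp add: Y_def v)

    have "measure_pmf.expectation (kernel h x) (?G s)
        \<le> ?G s x + h * (\<Sum>z\<in>F. Q x z * (?G s z - ?G s x)) + \<epsilon>1 * h * exp (\<theta> * C + v / (2 * \<rho>))"
    proof -
      have "\<bar>?G s y\<bar> \<le> exp (\<theta> * C + v / (2 * \<rho>))" for y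
        using potential_bounds(2)[where y=y, OF f \<theta>(1) \<rho> v0 s(1)] by (simp add: potential_def)
      from gen[of "?G s", OF this] show ?thesis by linarith
    qed
    also have "(\<Sum>z\<in>F. Q x z * (?G s z - ?G s x)) = ?G s x * (\<Sum>z\<in>F. Q x z * (exp (\<theta> * (?g s z - ?g s x)) - 1))"
      unfolding sum_distrib_left by (intro sum.cong refl, subst rat) (simp add: algebra_simps)
    also have "exp (\<theta> * C + v / (2 * \<rho>)) = exp (- \<theta> * C) * K"
      by (simp add: K_def exp_add[symmetric] algebra_simps)
    \<comment> \<open>The lower bound \<open>exp (- \<theta> * C)\<close> is replaced by
      \<open>?G s x\<close> itself, so that this factor can be pulled out of every term.\<close>
    also have "?G s x + h * (?G s x * (\<Sum>z\<in>F. Q x z * (exp (\<theta> * (?g s z - ?g s x)) - 1))) + \<epsilon>1 * h * (exp (- \<theta> * C) * K)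
        \<le> ?G s x + h * (?G s x * Y) + \<epsilon>1 * h * (?G s x * K)"
      using jumps Gpos h \<epsilon>1(1) K potential_bounds(1)[where y=x, OF f \<theta>(1) \<rho> v0 s(1)]
      by (intro add_mono mult_left_mono mult_right_mono order_refl) auto
    also have "\<dots> = ?G s x * (1 + (h * Y + \<epsilon>1 * h * K))" by (simp add: algebra_simps)
    also have "\<dots> \<le> ?G s x * exp (h * Y + \<epsilon>1 * h * K)"
      using Gpos by (intro mult_left_mono exp_ge_add_one_self) auto
    finally have upper: "measure_pmf.expectation (kernel h x) (?G s) \<le> ?G s x * exp (h * Y + \<epsilon>1 * h * K)" .

    \<comment> \<open>For the opposite direction, the exponent at \<open>s + h\<close> is bounded
      from below: first \<open>g\<close>, by the semigroup law and the same expansion over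
      \<open>F\<close>, then the correction term.\<close>
    have "?g (s + h) x = measure_pmf.expectation (kernel h x) (?g s)"
      using transition_op_add[where s=h and t=s and x=x, OF f] h s x by (simp add: add.commute)
    then have "?g s x + h * (\<Sum>z\<in>F. Q x z * (?g s z - ?g s x)) - \<epsilon>1 * h * C \<le> ?g (s + h) x"
      using gen[of "?g s", OF abs_transition_op_le[OF f]] by linarith
    then have "\<theta> * (?g s x + h * (\<Sum>z\<in>F. Q x z * (?g s z - ?g s x)) - \<epsilon>1 * h * C) \<le> \<theta> * ?g (s + h) x"
      using \<theta>(1) by (rule mult_left_mono)
    \<comment> \<open>The increment of the correction term is
      \<open>v * exp (- 2 * \<rho> * s)\<close> times
      \<open>(1 - exp (- (2 * \<rho> * h))) / (2 * \<rho>)\<close>, and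
      \<open>exp_le_quadratic\<close> at a negative argument bounds the last factor below by
      \<open>h - 2 * \<rho> * h * h\<close>.\<close>
    moreover have "v * (1 - exp (- 2 * \<rho> * s)) / (2 * \<rho>) + h * (v * exp (- 2 * \<rho> * s)) - v * (2 * \<rho>) * h * h
        \<le> v * (1 - exp (- 2 * \<rho> * (s + h))) / (2 * \<rho>)"
    proof -
      have "exp (- (2 * \<rho> * h)) \<le> 1 - 2 * \<rho> * h + (2 * \<rho> * h)\<^sup>2"
        using exp_le_quadratic[of "- (2 * \<rho> * h)"] mult_pos_pos[OF \<rho> h] by simp
      then have "2 * \<rho> * h - (2 * \<rho> * h)\<^sup>2 \<le> 1 - exp (- (2 * \<rho> * h))" by linarith
      then have "(2 * \<rho> * h - (2 * \<rho> * h)\<^sup>2) / (2 * \<rho>) \<le> (1 - exp (- (2 * \<rho> * h))) / (2 * \<rho>)"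
        using \<rho> by (intro divide_right_mono) auto
      then have "h - 2 * \<rho> * h * h \<le> (1 - exp (- (2 * \<rho> * h))) / (2 * \<rho>)"
        using \<rho> by (simp add: diff_divide_distrib power2_eq_square)
      then have "(v * exp (- 2 * \<rho> * s)) * (h - 2 * \<rho> * h * h) \<le> (v * exp (- 2 * \<rho> * s)) * ((1 - exp (- (2 * \<rho> * h))) / (2 * \<rho>))"
        using v0 by (intro mult_left_mono) auto
      also have "\<dots> = v * (1 - exp (- 2 * \<rho> * (s + h))) / (2 * \<rho>) - v * (1 - exp (- 2 * \<rho> * s)) / (2 * \<rho>)"
        by (simp add: diff_divide_distrib[symmetric] algebra_simps exp_add[symmetric])
      finally have "(v * exp (- 2 * \<rho> * s)) * (h - 2 * \<rho> * h * h) \<le> \<dots>" .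
      moreover have "(v * exp (- 2 * \<rho> * s)) * (2 * \<rho> * h * h) \<le> v * (2 * \<rho> * h * h)"
        using v0 \<rho> s h by (intro mult_right_mono mult_left_le) auto
      ultimately show ?thesis by (simp add: algebra_simps)
    qed
    moreover have "v * (2 * \<rho>) * h * h \<le> \<epsilon> / 2 * h" using hv h by (intro mult_right_mono) auto
    moreover have "\<epsilon>1 * h * K + \<theta> * (\<epsilon>1 * h * C) = \<epsilon> / 2 * h"
      unfolding \<epsilon>1(2)[symmetric] by (simp add: algebra_simps)
    ultimately have "\<theta> * ?g s x + v * (1 - exp (- 2 * \<rho> * s)) / (2 * \<rho>) + (h * Y + \<epsilon>1 * h * K)
        \<le> \<theta> * ?g (s + h) x + v * (1 - exp (- 2 * \<rho> * (s + h))) / (2 * \<rho>) + \<epsilon> * h"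
      by (simp add: Y_def algebra_simps)
    then have "?G s x * exp (h * Y + \<epsilon>1 * h * K) \<le> ?G (s + h) x * exp (\<epsilon> * h)"
      unfolding potential_def exp_add[symmetric] by (simp only: exp_le_cancel_iff)
    with upper show "measure_pmf.expectation (kernel h x) (?G s) \<le> ?G (s + h) x * exp (\<epsilon> * h)"
      by (rule order_trans)
  qed
qed

end

text \<open>Around every time there is an open interval on which the path takes at most two values,
  the left limit and the present value. Compactness leaves finitely many such intervals.\<close>

lemma finite_range_step_path:
  fixes p :: "real \<Rightarrow> 'a"
  assumes right: "\<And>s. 0 \<le> s \<Longrightarrow> \<exists>\<epsilon>>0. \<forall>r. s \<le> r \<and> r < s + \<epsilon> \<longrightarrow> p r = p s"
    and left: "\<And>s. 0 < s \<Longrightarrow> \<exists>\<epsilon>>0. \<exists>z. \<forall>r. s - \<epsilon> < r \<and> r < s \<longrightarrow> p r = z"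
  shows "finite (p ` {0..t})"
proof -
  define \<U> where "\<U> = {U. open U \<and> finite (p ` (U \<inter> {0..t}))}"
  have "\<exists>U\<in>\<U>. s \<in> U" if s: "s \<in> {0..t}" for s
  proof -
    obtain e1 where e1: "e1 > 0" "\<And>r. s \<le> r \<Longrightarrow> r < s + e1 \<Longrightarrow> p r = p s"
      using right[of s] s by auto
    \<comment> \<open>At \<open>s = 0\<close> there are no earlier times in the range considered, so
      any positive radius will do.\<close>
    obtain e2 z where e2: "e2 > 0" "\<And>r. 0 \<le> r \<Longrightarrow> s - e2 < r \<Longrightarrow> r < s \<Longrightarrow> p r = z"
      using left[of s] s by (cases "s = 0") (auto intro: zero_less_one)
    have "p r \<in> {z, p s}" if "r \<in> {s - e2<..<s + e1} \<inter> {0..t}" for r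
      using e1(2)[of r] e2(2)[of r] that by (cases "r < s") auto
    then have "p ` ({s - e2<..<s + e1} \<inter> {0..t}) \<subseteq> {z, p s}"
      by blast
    then have "{s - e2<..<s + e1} \<in> \<U>"
      by (auto simp: \<U>_def intro: finite_subset)
    moreover have "s \<in> {s - e2<..<s + e1}" using e1 e2 by simp
    ultimately show ?thesis by blast
  qed
  then have "{0..t} \<subseteq> \<Union>\<U>" by blast
  moreover have "\<forall>U\<in>\<U>. open U" by (simp add: \<U>_def)
  ultimately obtain \<V> where \<V>: "\<V> \<subseteq> \<U>" "finite \<V>" "{0..t} \<subseteq> \<Union>\<V>"
    using compactE[OF compact_Icc[of 0 t], of \<U>] by metis
  have "p ` {0..t} \<subseteq> (\<Union>U\<in>\<V>. p ` (U \<inter> {0..t}))" using \<V>(3) by blast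
  then show ?thesis
    by (rule finite_subset) (use \<V> in \<open>auto simp: \<U>_def\<close>)
qed

subsection \<open>Path realisations\<close>

locale Q_chain = Q_process S Q P
  for S :: "'a set" and Q P +
  fixes M :: "'w measure" and X :: "real \<Rightarrow> 'w \<Rightarrow> 'a" and x0 :: 'a
  assumes chain: "markov_chain_from S P M X x0" and x0_in_S: "x0 \<in> S"

sublocale Q_chain \<subseteq> prob_space M
  using chain by (simp add: markov_chain_from_def)

context Q_chain begin

lemma X_measurable: "0 \<le> t \<Longrightarrow> X t \<in> measurable M (count_space UNIV)"
  and X_in_S: "\<omega> \<in> space M \<Longrightarrow> 0 \<le> t \<Longrightarrow> X t \<omega> \<in> S"
  and X_right: "\<omega> \<in> space M \<Longrightarrow> 0 \<le> t \<Longrightarrow>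
        \<exists>\<epsilon>>0. \<forall>s. t \<le> s \<and> s < t + \<epsilon> \<longrightarrow> X s \<omega> = X t \<omega>"
  and X_left: "\<omega> \<in> space M \<Longrightarrow> 0 < t \<Longrightarrow>
        \<exists>\<epsilon>>0. \<exists>z. \<forall>s. t - \<epsilon> < s \<and> s < t \<longrightarrow> X s \<omega> = z"
  using chain by (auto simp: markov_chain_from_def)

lemma sets_X:
  assumes "0 \<le> t"
  shows "{\<omega> \<in> space M. R (X t \<omega>)} \<in> sets M"
proof -
  have "{\<omega> \<in> space M. R (X t \<omega>)} = X t -` Collect R \<inter> space M" by blast
  then show ?thesis using measurable_sets[OF X_measurable[OF assms], of "Collect R"] by simp
qed

lemma borel_measurable_X:
  fixes u :: "'a \<Rightarrow> 'b :: topological_space"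
  shows "0 \<le> t \<Longrightarrow> (\<lambda>\<omega>. u (X t \<omega>)) \<in> borel_measurable M"
  by (rule measurable_compose[OF X_measurable]) auto

lemma sets_grid:
  assumes "0 \<le> h"
  shows "{\<omega> \<in> space M. \<forall>i<n. R i (X (real i * h) \<omega>)} \<in> sets M"
proof -
  have "{\<omega> \<in> space M. \<forall>i\<in>{..<n}. R i (X (real i * h) \<omega>)} \<in> sets M"
    using assms by (intro sets.sets_Collect_finite_All sets_X) auto
  then show ?thesis by (simp only: Ball_def lessThan_iff)
qed

section \<open>Finite-dimensional laws and the Markov property on a grid\<close>

lemma prob_finite_dim:
  assumes "\<And>i. i < n \<Longrightarrow> 0 \<le> ts i" "\<And>i. i < n \<Longrightarrow> xs i \<in> S" "\<And>i. Suc i < n \<Longrightarrow> ts i \<le> ts (Suc i)"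
  shows "prob {\<omega> \<in> space M. \<forall>i<n. X (ts i) \<omega> = xs i} =
          (\<Prod>i<n. P (if i = 0 then ts 0 else ts i - ts (i - 1))
                      (if i = 0 then x0 else xs (i - 1)) (xs i))"
  by (rule chain[unfolded markov_chain_from_def, THEN conjunct2, THEN conjunct2, THEN conjunct2,
        THEN conjunct2, THEN conjunct2, rule_format])
     (use assms in blast)

lemma prob_X_eq:
  assumes "0 \<le> t" "y \<in> S"
  shows "prob {\<omega> \<in> space M. X t \<omega> = y} = P t x0 y"
  using prob_finite_dim[of 1 "\<lambda>_. t" "\<lambda>_. y"] assms by simp

text \<open>Since \<open>S\<close> is countable, splitting over the value of \<open>Y\<close>
  reduces the integral to point probabilities. With \<open>A\<close> the whole space this yields the
  law of \<open>X t\<close>; with \<open>A\<close> a history along the grid it yields the Markov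
  property.\<close>

lemma nn_integral_conditional_law:
  assumes Y[measurable]: "Y \<in> measurable M (count_space UNIV)" and YS: "\<And>\<omega>. \<omega> \<in> space M \<Longrightarrow> Y \<omega> \<in> S"
    and A[measurable]: "A \<in> sets M" and c: "0 \<le> c" and p: "0 \<le> t" "x \<in> S"
    and law: "\<And>y. y \<in> S \<Longrightarrow> prob (A \<inter> {\<omega> \<in> space M. Y \<omega> = y}) = c * P t x y"
  shows "(\<integral>\<^sup>+\<omega>. indicator A \<omega> * u (Y \<omega>) \<partial>M) = ennreal c * (\<integral>\<^sup>+y. u y \<partial>kernel t x)"
proof -
  have "(\<integral>\<^sup>+\<omega>. indicator A \<omega> * u (Y \<omega>) \<partial>M) =
      (\<integral>\<^sup>+\<omega>. (\<integral>\<^sup>+y. u y * indicator (A \<inter> {\<omega> \<in> space M. Y \<omega> = y}) \<omega> \<partial>count_space S) \<partial>M)"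
  proof (rule nn_integral_cong)
    fix \<omega> assume \<omega>: "\<omega> \<in> space M"
    have "(\<integral>\<^sup>+y. u y * indicator (A \<inter> {\<omega> \<in> space M. Y \<omega> = y}) \<omega> \<partial>count_space S) =
        (\<integral>\<^sup>+y. (indicator A \<omega> * u (Y \<omega>)) * indicator {Y \<omega>} y \<partial>count_space S)"
      using \<omega> by (intro nn_integral_cong) (auto split: split_indicator)
    also have "\<dots> = indicator A \<omega> * u (Y \<omega>)"
      using YS[OF \<omega>] by (subst nn_integral_cmult_indicator) auto
    finally show "indicator A \<omega> * u (Y \<omega>) =
        (\<integral>\<^sup>+y. u y * indicator (A \<inter> {\<omega> \<in> space M. Y \<omega> = y}) \<omega> \<partial>count_space S)" ..
  qed
  also have "\<dots> = (\<integral>\<^sup>+y. (\<integral>\<^sup>+\<omega>. u y * indicator (A \<inter> {\<omega> \<in> space M. Y \<omega> = y}) \<omega> \<partial>M) \<partial>count_space S)"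
    by (intro nn_integral_count_space_nn_integral countable_S) measurable
  also have "\<dots> = (\<integral>\<^sup>+y. ennreal c * (ennreal (P t x y) * u y) \<partial>count_space S)"
  proof (rule nn_integral_cong)
    fix y assume "y \<in> space (count_space S)"
    then have "emeasure M (A \<inter> {\<omega> \<in> space M. Y \<omega> = y}) = ennreal c * ennreal (P t x y)"
      using c by (simp add: emeasure_eq_measure law ennreal_mult')
    then show "(\<integral>\<^sup>+\<omega>. u y * indicator (A \<inter> {\<omega> \<in> space M. Y \<omega> = y}) \<omega> \<partial>M) = ennreal c * (ennreal (P t x y) * u y)"
      by (subst nn_integral_cmult_indicator) (simp_all add: mult.left_commute mult.commute)
  qed
  also have "\<dots> = ennreal c * (\<integral>\<^sup>+y. u y \<partial>kernel t x)"
    by (simp add: nn_integral_cmult nn_integral_kernel[OF p])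
  finally show ?thesis .
qed

lemma distr_X:
  assumes t: "0 \<le> t"
  shows "distr M (count_space UNIV) (X t) = measure_pmf (kernel t x0)"
proof (rule measure_eqI)
  fix B :: "'a set"
  have "emeasure (kernel t x0) B = ennreal 1 * (\<integral>\<^sup>+y. indicator B y \<partial>kernel t x0)"
    by (subst nn_integral_indicator) auto
  also have "\<dots> = (\<integral>\<^sup>+\<omega>. indicator (space M) \<omega> * indicator B (X t \<omega>) \<partial>M)"
  proof (rule nn_integral_conditional_law[symmetric])
    fix y assume "y \<in> S"
    have "space M \<inter> {\<omega> \<in> space M. X t \<omega> = y} = {\<omega> \<in> space M. X t \<omega> = y}" by auto
    with \<open>y \<in> S\<close> show "prob (space M \<inter> {\<omega> \<in> space M. X t \<omega> = y}) = 1 * P t x0 y"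
      using prob_X_eq t by simp
  qed (use t X_in_S X_measurable x0_in_S in auto)
  also have "\<dots> = (\<integral>\<^sup>+\<omega>. indicator (X t -` B \<inter> space M) \<omega> \<partial>M)"
    by (intro nn_integral_cong) (auto split: split_indicator)
  also have "\<dots> = emeasure M (X t -` B \<inter> space M)"
    using measurable_sets[OF X_measurable[OF t], of B] by (intro nn_integral_indicator) auto
  also have "\<dots> = emeasure (distr M (count_space UNIV) (X t)) B"
    by (rule emeasure_distr[OF X_measurable[OF t], symmetric]) auto
  finally show "emeasure (distr M (count_space UNIV) (X t)) B = emeasure (kernel t x0) B" ..
qed (simp only: sets_distr sets_measure_pmf sets_count_space Pow_UNIV)

lemma expectation_X:
  fixes f :: "'a \<Rightarrow> real"
  assumes "0 \<le> t"
  shows "expectation (\<lambda>\<omega>. f (X t \<omega>)) = transition_op f t x0"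
  unfolding transition_op_def distr_X[OF assms, symmetric]
  using X_measurable[OF assms] by (subst integral_distr) auto

text \<open>The starting point is prescribed only through the law, by \<open>P 0 x0 x0 = 1\<close>,
  hence only almost surely.\<close>

lemma AE_X_0: "AE \<omega> in M. X 0 \<omega> = x0"
  using prob_X_eq[of 0 x0] x0_in_S sets_X[of 0 "\<lambda>x. x = x0"]
  by (subst prob_Collect_eq_1[symmetric]) (auto simp: P_0)

text \<open>The event \<open>A\<close> splits into finitely many histories with values in the finite
  set \<open>F\<close>. Each has a product as its probability, and the additional step multiplies
  all of these by the same factor \<open>P h z y\<close>.\<close>

lemma markov_step:
  fixes k :: nat
  assumes h: "0 \<le> h" and F: "finite F" "F \<subseteq> S" "z \<in> F" and y: "y \<in> S"
  defines "A \<equiv> {\<omega> \<in> space M. (\<forall>i<k. X (real i * h) \<omega> \<in> F) \<and> X (real k * h) \<omega> = z}"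
  shows "prob (A \<inter> {\<omega> \<in> space M. X (real (Suc k) * h) \<omega> = y}) = prob A * P h z y"
proof -
  define I where "I = (PiE {..<k} (\<lambda>_. F))"
  have finI: "finite I" using F by (simp add: I_def finite_PiE)
  \<comment> \<open>One trajectory serves both events: its first \<open>Suc k\<close> entries
    describe a history ending in \<open>z\<close>, and one entry more adds the step to
    \<open>y\<close>.\<close>
  define path where "path xs i = (if i < k then xs i else if i = k then z else y)" for xs :: "nat \<Rightarrow> 'a" and i
  define E where "E n xs = {\<omega> \<in> space M. \<forall>i<n. X (real i * h) \<omega> = path xs i}" for n xs
  have E_sets[measurable]: "E n xs \<in> sets M" for n xs
    unfolding E_def using h by (rule sets_grid)
  have pathS: "path xs i \<in> S" if "xs \<in> I" for xs i
    using that F y PiE_mem[of xs "{..<k}" "\<lambda>_. F" i] by (auto simp: path_def I_def)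
  have prE: "prob (E n xs) = (\<Prod>i<n. P (if i = 0 then 0 else h) (if i = 0 then x0 else path xs (i - 1)) (path xs i))"
    if "xs \<in> I" for n xs
    unfolding E_def using prob_finite_dim[of n "\<lambda>i. real i * h" "path xs"] that pathS h
    by (auto simp: algebra_simps of_nat_diff intro!: prod.cong mult_right_mono)
  have inj: "xs = xs'" if "xs \<in> I" "xs' \<in> I" "\<omega> \<in> E n xs" "\<omega> \<in> E n xs'" "k \<le> n" for xs xs' \<omega> n
  proof (rule PiE_ext)
    fix i assume "i \<in> {..<k}"
    then have "i < k" "i < n" using that by auto
    then have "path xs i = path xs' i" using that(3,4) by (auto simp: E_def)
    then show "xs i = xs' i" using \<open>i < k\<close> by (simp add: path_def)
  qed (use that in \<open>auto simp: I_def\<close>)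
  have disj: "disjoint_family_on (E n) I" if "k \<le> n" for n
    using inj that unfolding disjoint_family_on_def by blast
  have A: "A = (\<Union>xs\<in>I. E (Suc k) xs)"
  proof (intro subset_antisym subsetI)
    fix \<omega> assume "\<omega> \<in> A"
    then have "restrict (\<lambda>i. X (real i * h) \<omega>) {..<k} \<in> I" "\<omega> \<in> E (Suc k) (restrict (\<lambda>i. X (real i * h) \<omega>) {..<k})"
      by (auto simp: A_def E_def I_def path_def less_Suc_eq)
    then show "\<omega> \<in> (\<Union>xs\<in>I. E (Suc k) xs)" by blast
  qed (force simp: A_def E_def I_def path_def PiE_def Pi_def less_Suc_eq)
  have Ay: "A \<inter> {\<omega> \<in> space M. X (real (Suc k) * h) \<omega> = y} = (\<Union>xs\<in>I. E (Suc (Suc k)) xs)"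
    unfolding A by (auto simp: E_def path_def less_Suc_eq)
  have "prob (A \<inter> {\<omega> \<in> space M. X (real (Suc k) * h) \<omega> = y}) = (\<Sum>xs\<in>I. prob (E (Suc (Suc k)) xs))"
    unfolding Ay by (rule finite_measure_finite_Union[OF finI _ disj]) auto
  also have "\<dots> = (\<Sum>xs\<in>I. prob (E (Suc k) xs) * P h z y)"
    by (intro sum.cong refl) (simp add: prE path_def)
  also have "\<dots> = prob A * P h z y"
    unfolding A sum_distrib_right[symmetric]
    by (subst finite_measure_finite_Union[OF finI _ disj]) auto
  finally show ?thesis .
qed

text \<open>A discrete supermartingale argument for the chain killed on leaving \<open>F\<close>:
  conditioning on the state at step \<open>n\<close> removes the last step at the price of a factor
  \<open>c\<close>. Only the times \<open>i < n\<close> are constrained, so the final state may lie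
  outside \<open>F\<close>; this matches the strict inequality \<open>s < t\<close> in the event of
  interest.\<close>

lemma nn_integral_grid_le:
  assumes h: "0 \<le> h" and F: "finite F" "F \<subseteq> S"
    and step: "\<And>k z. k < n \<Longrightarrow> z \<in> F \<Longrightarrow> (\<integral>\<^sup>+y. W (Suc k) y \<partial>kernel h z) \<le> c * W k z"
  shows "(\<integral>\<^sup>+\<omega>. indicator {\<omega> \<in> space M. \<forall>i<n. X (real i * h) \<omega> \<in> F} \<omega> * W n (X (real n * h) \<omega>) \<partial>M)
          \<le> c ^ n * (W 0 x0 :: ennreal)"
  using step
proof (induction n)
  case 0
  have "(\<integral>\<^sup>+\<omega>. indicator {\<omega> \<in> space M. \<forall>i<0. X (real i * h) \<omega> \<in> F} \<omega> * W 0 (X (real 0 * h) \<omega>) \<partial>M)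
      = (\<integral>\<^sup>+\<omega>. W 0 x0 \<partial>M)"
    by (rule nn_integral_cong_AE) (use AE_X_0 in \<open>auto elim!: eventually_mono\<close>)
  then show ?case by (simp add: emeasure_space_1)
next
  case (Suc n)
  let ?A = "\<lambda>z. {\<omega> \<in> space M. (\<forall>i<n. X (real i * h) \<omega> \<in> F) \<and> X (real n * h) \<omega> = z}"
  have grid: "0 \<le> real k * h" for k using h by simp
  have A: "?A z \<in> sets M" for z
    using h by (intro sets.sets_Collect_conj sets_grid sets_X) auto
  have "(\<integral>\<^sup>+\<omega>. indicator {\<omega> \<in> space M. \<forall>i<Suc n. X (real i * h) \<omega> \<in> F} \<omega> * W (Suc n) (X (real (Suc n) * h) \<omega>) \<partial>M)
      = (\<integral>\<^sup>+\<omega>. (\<Sum>z\<in>F. indicator (?A z) \<omega> * W (Suc n) (X (real (Suc n) * h) \<omega>)) \<partial>M)"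
  proof (rule nn_integral_cong)
    fix \<omega> assume \<omega>: "\<omega> \<in> space M"
    have "indicator {\<omega> \<in> space M. \<forall>i<Suc n. X (real i * h) \<omega> \<in> F} \<omega> = (\<Sum>z\<in>F. indicator (?A z) \<omega> :: ennreal)"
    proof (cases "\<forall>i<Suc n. X (real i * h) \<omega> \<in> F")
      case True
      then have "(\<Sum>z\<in>F. indicator (?A z) \<omega> :: ennreal) = (\<Sum>z\<in>{X (real n * h) \<omega>}. indicator (?A z) \<omega>)"
        using F \<omega> by (intro sum.mono_neutral_right) (auto split: split_indicator)
      with True \<omega> show ?thesis by simp
    next
      case False
      then have "\<omega> \<notin> ?A z" if "z \<in> F" for z
        using that by (auto simp: less_Suc_eq)
      with False show ?thesis by simp
    qed
    then show "indicator {\<omega> \<in> space M. \<forall>i<Suc n. X (real i * h) \<omega> \<in> F} \<omega> * W (Suc n) (X (real (Suc n) * h) \<omega>)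
        = (\<Sum>z\<in>F. indicator (?A z) \<omega> * W (Suc n) (X (real (Suc n) * h) \<omega>))"
      by (simp add: sum_distrib_right)
  qed
  also have "\<dots> = (\<Sum>z\<in>F. \<integral>\<^sup>+\<omega>. indicator (?A z) \<omega> * W (Suc n) (X (real (Suc n) * h) \<omega>) \<partial>M)"
    by (intro nn_integral_sum borel_measurable_times_ennreal borel_measurable_indicator A borel_measurable_X grid)
  also have "\<dots> = (\<Sum>z\<in>F. ennreal (prob (?A z)) * (\<integral>\<^sup>+y. W (Suc n) y \<partial>kernel h z))"
  proof (intro sum.cong refl)
    fix z assume z: "z \<in> F"
    show "(\<integral>\<^sup>+\<omega>. indicator (?A z) \<omega> * W (Suc n) (X (real (Suc n) * h) \<omega>) \<partial>M)
        = ennreal (prob (?A z)) * (\<integral>\<^sup>+y. W (Suc n) y \<partial>kernel h z)"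
    proof (rule nn_integral_conditional_law)
      show "z \<in> S" using z F by blast
      show "X (real (Suc n) * h) \<omega> \<in> S" if "\<omega> \<in> space M" for \<omega>
        by (rule X_in_S[OF that grid])
    qed (rule X_measurable[OF grid] A measure_nonneg h markov_step[OF h F z]; assumption?)+
  qed
  also have "\<dots> \<le> (\<Sum>z\<in>F. ennreal (prob (?A z)) * (c * W n z))"
    by (intro sum_mono mult_left_mono Suc.prems) auto
  also have "\<dots> = (\<Sum>z\<in>F. \<integral>\<^sup>+\<omega>. (c * W n z) * indicator (?A z) \<omega> \<partial>M)"
    by (simp only: nn_integral_cmult_indicator[OF A] emeasure_eq_measure mult.commute[of "ennreal _"])
  also have "\<dots> = (\<integral>\<^sup>+\<omega>. (\<Sum>z\<in>F. (c * W n z) * indicator (?A z) \<omega>) \<partial>M)"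
    by (intro nn_integral_sum[symmetric] borel_measurable_times_ennreal borel_measurable_indicator A borel_measurable_const)
  also have "\<dots> \<le> (\<integral>\<^sup>+\<omega>. c * (indicator {\<omega> \<in> space M. \<forall>i<n. X (real i * h) \<omega> \<in> F} \<omega> * W n (X (real n * h) \<omega>)) \<partial>M)"
  proof (rule nn_integral_mono)
    fix \<omega> assume \<omega>: "\<omega> \<in> space M"
    have "(\<Sum>z\<in>F. (c * W n z) * indicator (?A z) \<omega>)
        \<le> (\<Sum>z\<in>F. if X (real n * h) \<omega> = z then
              c * (indicator {\<omega> \<in> space M. \<forall>i<n. X (real i * h) \<omega> \<in> F} \<omega> * W n (X (real n * h) \<omega>)) else 0)"
      by (intro sum_mono) (auto split: split_indicator)
    also have "\<dots> \<le> c * (indicator {\<omega> \<in> space M. \<forall>i<n. X (real i * h) \<omega> \<in> F} \<omega> * W n (X (real n * h) \<omega>))"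
      using F by (simp add: sum.delta)
    finally show "(\<Sum>z\<in>F. (c * W n z) * indicator (?A z) \<omega>)
        \<le> c * (indicator {\<omega> \<in> space M. \<forall>i<n. X (real i * h) \<omega> \<in> F} \<omega> * W n (X (real n * h) \<omega>))" .
  qed
  also have "\<dots> = c * (\<integral>\<^sup>+\<omega>. indicator {\<omega> \<in> space M. \<forall>i<n. X (real i * h) \<omega> \<in> F} \<omega> * W n (X (real n * h) \<omega>) \<partial>M)"
    by (intro nn_integral_cmult borel_measurable_times_ennreal borel_measurable_indicator sets_grid[OF h] borel_measurable_X grid)
  also have "\<dots> \<le> c * (c ^ n * W 0 x0)"
    by (intro mult_left_mono Suc.IH Suc.prems) auto
  finally show ?case by (simp add: mult.assoc)
qed

section \<open>The event of staying in a set\<close>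

definition stays :: "'a set \<Rightarrow> real \<Rightarrow> 'w set" where
  "stays F t = {\<omega> \<in> space M. \<forall>s. 0 \<le> s \<and> s < t \<longrightarrow> X s \<omega> \<in> F}"

text \<open>By right-continuity it suffices to test the rational times before \<open>t\<close>, of
  which there are countably many.\<close>

lemma sets_stays: "stays F t \<in> sets M"
proof -
  define R where "R = \<rat> \<inter> {0..<t}"
  have "stays F t = {\<omega> \<in> space M. \<forall>s\<in>R. X s \<omega> \<in> F}"
  proof (intro subset_antisym subsetI)
    fix \<omega> assume \<omega>: "\<omega> \<in> {\<omega> \<in> space M. \<forall>s\<in>R. X s \<omega> \<in> F}"
    have "X s \<omega> \<in> F" if s: "0 \<le> s" "s < t" for s
    proof -
      obtain \<epsilon> where \<epsilon>: "\<epsilon> > 0" "\<forall>r. s \<le> r \<and> r < s + \<epsilon> \<longrightarrow> X r \<omega> = X s \<omega>"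
        using X_right[of \<omega> s] \<omega> s by auto
      obtain r where r: "r \<in> \<rat>" "s < r" "r < min t (s + \<epsilon>)"
        using Rats_dense_in_real[of s "min t (s + \<epsilon>)"] s \<epsilon> by auto
      then have "r \<in> R" using s by (auto simp: R_def)
      then have "X r \<omega> \<in> F" using \<omega> by blast
      moreover have "X r \<omega> = X s \<omega>" using \<epsilon>(2)[rule_format, of r] r by simp
      ultimately show ?thesis by simp
    qed
    then show "\<omega> \<in> stays F t" using \<omega> by (auto simp: stays_def)
  qed (auto simp: stays_def R_def)
  also have "\<dots> \<in> sets M"
  proof (rule sets.sets_Collect_countable_All')
    show "countable R" by (auto simp: R_def countable_rat)
  qed (auto simp: R_def intro: sets_X)
  finally show ?thesis .
qed

subsection \<open>Deviation bounds\<close>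

text \<open>The one-step inequality is iterated along a grid of mesh \<open>h\<close>. The error
  factors multiply to \<open>exp (\<epsilon> * t)\<close> whatever the number of steps, so
  \<epsilon> can be sent to 0 at the end.\<close>

lemma nn_integral_exp_stays_le:
  assumes f: "\<And>y. \<bar>f y\<bar> \<le> C" and F: "finite F" "F \<subseteq> S" and \<rho>: "0 < \<rho>"
    and \<theta>: "0 \<le> \<theta>" "\<theta> * B \<le> 3/2" and B: "0 \<le> B" and t: "0 < t" "t \<le> T"
    and rate: "\<And>x. x \<in> F \<Longrightarrow> (\<Sum>\<^sub>\<infinity>y\<in>nbhd S Q x. Q x y) \<le> q" and q: "0 \<le> q"
    and contr: "\<And>x z s. x \<in> F \<Longrightarrow> z \<in> nbhd S Q x \<Longrightarrow> 0 \<le> s \<Longrightarrow> s \<le> T \<Longrightarrow>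
      \<bar>transition_op f s z - transition_op f s x\<bar> \<le> B * exp (- \<rho> * s)"
  defines "v \<equiv> q * (\<theta> * B)\<^sup>2"
  shows "(\<integral>\<^sup>+\<omega>. indicator (stays F t) \<omega> * ennreal (exp (\<theta> * f (X t \<omega>))) \<partial>M)
    \<le> ennreal (exp (\<theta> * transition_op f t x0 + v / (2 * \<rho>)))" (is "?I \<le> ennreal ?K")
proof -
  have v: "0 \<le> v" using q by (simp add: v_def)
  have bound: "?I \<le> ennreal (?K * exp (\<epsilon> * t))" if \<epsilon>: "0 < \<epsilon>" for \<epsilon>
  proof -
    \<comment> \<open>Finiteness of \<open>F\<close> allows a common threshold for \<open>h\<close>
      at all its states.\<close>
    have "\<forall>\<^sub>F h in at_right 0. \<forall>x\<in>F. \<forall>s. 0 \<le> s \<and> s \<le> T \<longrightarrow>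
        measure_pmf.expectation (kernel h x) (potential f \<theta> \<rho> v s)
          \<le> potential f \<theta> \<rho> v (s + h) x * exp (\<epsilon> * h)"
      using F contr by (intro eventually_ball_finite ballI potential_one_step[OF f _ \<rho> \<theta> B rate _ v_def[THEN meta_eq_to_obj_eq] \<epsilon>]) auto
    then obtain h0 where h0: "0 < h0" and
      step: "\<And>h x s. 0 < h \<Longrightarrow> h < h0 \<Longrightarrow> x \<in> F \<Longrightarrow> 0 \<le> s \<Longrightarrow> s \<le> T \<Longrightarrow>
        measure_pmf.expectation (kernel h x) (potential f \<theta> \<rho> v s)
          \<le> potential f \<theta> \<rho> v (s + h) x * exp (\<epsilon> * h)"
      unfolding eventually_at_right_field by blast
    obtain n :: nat where n: "t / h0 < real n" using reals_Archimedean2 by blast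
    then have n0: "0 < real n" using t h0 by (meson divide_pos_pos less_trans)
    define h where "h = t / real n"
    have h: "0 < h" "h < h0" and nh: "real n * h = t"
      using n n0 t h0 by (auto simp: h_def field_simps)
    \<comment> \<open>After \<open>k\<close> steps the remaining time is
      \<open>t - real k * h\<close>. Thus \<open>W n\<close> is \<open>exp (\<theta> * f)\<close> on
      \<open>S\<close>, and \<open>W 0 x0\<close> contains the mean of \<open>f (X t)\<close> in its
      exponent.\<close>
    define W where "W k y = ennreal (potential f \<theta> \<rho> v (t - real k * h) y)" for k y
    have "(\<integral>\<^sup>+\<omega>. indicator {\<omega> \<in> space M. \<forall>i<n. X (real i * h) \<omega> \<in> F} \<omega> * W n (X (real n * h) \<omega>) \<partial>M)
          \<le> ennreal (exp (\<epsilon> * h)) ^ n * W 0 x0"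
    proof (rule nn_integral_grid_le[OF less_imp_le[OF h(1)] F])
      fix k z assume k: "k < n" and z: "z \<in> F"
      have "real (Suc k) * h \<le> real n * h" using k h by (intro mult_right_mono) auto
      then have s: "0 \<le> t - real (Suc k) * h" "t - real (Suc k) * h \<le> T"
        using nh t mult_nonneg_nonneg[of "real (Suc k)" h] h by linarith+
      have pos: "0 \<le> potential f \<theta> \<rho> v s y" for s y by (simp add: potential_def)
      have "integrable (measure_pmf (kernel h z)) (potential f \<theta> \<rho> v (t - real (Suc k) * h))"
        using potential_bounds(2)[where f=f, OF f \<theta>(1) \<rho> v s(1)] pos
        by (intro integrable_bounded_pmf[where C="exp (\<theta> * C + v / (2 * \<rho>))"]) simp
      then have "(\<integral>\<^sup>+y. W (Suc k) y \<partial>kernel h z)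
          = ennreal (measure_pmf.expectation (kernel h z) (potential f \<theta> \<rho> v (t - real (Suc k) * h)))"
        unfolding W_def by (intro nn_integral_eq_integral) (auto simp: pos)
      also have "\<dots> \<le> ennreal (potential f \<theta> \<rho> v (t - real (Suc k) * h + h) z * exp (\<epsilon> * h))"
        by (intro ennreal_leI step h z s)
      also have "t - real (Suc k) * h + h = t - real k * h" by (simp add: algebra_simps)
      finally show "(\<integral>\<^sup>+y. W (Suc k) y \<partial>kernel h z) \<le> ennreal (exp (\<epsilon> * h)) * W k z"
        by (simp add: W_def ennreal_mult' pos mult.commute)
    qed
    also have "W 0 x0 \<le> ennreal ?K"
    proof -
      have "v * (1 - exp (- (2 * \<rho> * t))) \<le> v"
        using v by (intro mult_left_le) auto
      then show ?thesis
        using \<rho> by (auto simp: W_def potential_def divide_right_mono intro!: ennreal_leI)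
    qed
    also have "ennreal (exp (\<epsilon> * h)) ^ n * ennreal ?K = ennreal (?K * exp (\<epsilon> * t))"
      by (simp add: ennreal_power ennreal_mult'[symmetric] exp_of_nat_mult[symmetric] nh[symmetric] ac_simps)
    finally have grid: "(\<integral>\<^sup>+\<omega>. indicator {\<omega> \<in> space M. \<forall>i<n. X (real i * h) \<omega> \<in> F} \<omega> * W n (X (real n * h) \<omega>) \<partial>M)
        \<le> ennreal (?K * exp (\<epsilon> * t))" by (simp add: mult_left_mono)
    \<comment> \<open>Staying in \<open>F\<close> on all of [0, t) forces the grid points before
      \<open>t\<close> into \<open>F\<close>, so the grid event is the larger one.\<close>
    have "?I \<le> (\<integral>\<^sup>+\<omega>. indicator {\<omega> \<in> space M. \<forall>i<n. X (real i * h) \<omega> \<in> F} \<omega> * W n (X (real n * h) \<omega>) \<partial>M)"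
    proof (rule nn_integral_mono)
      fix \<omega> assume \<omega>: "\<omega> \<in> space M"
      have "W n (X (real n * h) \<omega>) = ennreal (exp (\<theta> * f (X t \<omega>)))"
        using X_in_S[OF \<omega>, of t] t by (simp add: W_def nh potential_def transition_op_def kernel_0)
      moreover have "X (real i * h) \<omega> \<in> F" if "\<omega> \<in> stays F t" "i < n" for i
      proof -
        have "real i * h < real n * h" using that h by simp
        then show ?thesis using that h nh by (auto simp: stays_def)
      qed
      ultimately show "indicator (stays F t) \<omega> * ennreal (exp (\<theta> * f (X t \<omega>)))
          \<le> indicator {\<omega> \<in> space M. \<forall>i<n. X (real i * h) \<omega> \<in> F} \<omega> * W n (X (real n * h) \<omega>)"
        using \<omega> by (auto split: split_indicator)
    qed
    with grid show ?thesis by (rule order_trans[rotated])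
  qed
  have "((\<lambda>\<epsilon>. ennreal (?K * exp (\<epsilon> * t))) \<longlongrightarrow> ennreal (?K * exp (0 * t))) (at_right 0)"
    by (intro tendsto_intros)
  then show ?thesis
    using tendsto_lowerbound[of "\<lambda>\<epsilon>. ennreal (?K * exp (\<epsilon> * t))" "ennreal ?K" "at_right 0" ?I] bound
    by (simp add: eventually_at_right_less[THEN eventually_mono])
qed

text \<open>The exponential Markov inequality, restricted to the event
  \<open>stays F t\<close>.\<close>

lemma prob_deviation_stays_finite_le:
  assumes f: "\<And>y. \<bar>f y\<bar> \<le> C" and F: "finite F" "F \<subseteq> S" and \<rho>: "0 < \<rho>"
    and \<theta>: "0 \<le> \<theta>" "\<theta> * B \<le> 3/2" and B: "0 \<le> B" and t: "0 < t" "t \<le> T"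
    and rate: "\<And>x. x \<in> F \<Longrightarrow> (\<Sum>\<^sub>\<infinity>y\<in>nbhd S Q x. Q x y) \<le> q" and q: "0 \<le> q"
    and contr: "\<And>x z s. x \<in> F \<Longrightarrow> z \<in> nbhd S Q x \<Longrightarrow> 0 \<le> s \<Longrightarrow> s \<le> T \<Longrightarrow>
      \<bar>transition_op f s z - transition_op f s x\<bar> \<le> B * exp (- \<rho> * s)"
  shows "prob ({\<omega> \<in> space M. transition_op f t x0 + m \<le> f (X t \<omega>)} \<inter> stays F t)
    \<le> exp (q * (\<theta> * B)\<^sup>2 / (2 * \<rho>) - \<theta> * m)"
proof -
  let ?E = "{\<omega> \<in> space M. transition_op f t x0 + m \<le> f (X t \<omega>)} \<inter> stays F t"
  let ?c = "exp (- \<theta> * (transition_op f t x0 + m))"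
  have E: "?E \<in> sets M" using t by (intro sets.Int sets_X sets_stays) auto
  have meas: "(\<lambda>\<omega>. indicator (stays F t) \<omega> * ennreal (exp (\<theta> * f (X t \<omega>)))) \<in> borel_measurable M"
    using t by (intro borel_measurable_times_ennreal borel_measurable_indicator sets_stays borel_measurable_X) auto
  have "ennreal (prob ?E) = (\<integral>\<^sup>+\<omega>. indicator ?E \<omega> \<partial>M)"
    by (simp only: nn_integral_indicator[OF E] emeasure_eq_measure)
  also have "\<dots> \<le> (\<integral>\<^sup>+\<omega>. ennreal ?c * (indicator (stays F t) \<omega> * ennreal (exp (\<theta> * f (X t \<omega>)))) \<partial>M)"
  proof (rule nn_integral_mono)
    fix \<omega>
    have "1 \<le> ?c * exp (\<theta> * f (X t \<omega>))" if "\<omega> \<in> ?E"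
    proof -
      have "\<theta> * (transition_op f t x0 + m) \<le> \<theta> * f (X t \<omega>)"
        using that \<theta> by (intro mult_left_mono) auto
      then show ?thesis by (simp add: exp_add[symmetric])
    qed
    then show "indicator ?E \<omega> \<le> ennreal ?c * (indicator (stays F t) \<omega> * ennreal (exp (\<theta> * f (X t \<omega>))))"
      by (auto split: split_indicator simp: ennreal_mult'[symmetric] simp flip: ennreal_1 intro!: ennreal_leI)
  qed
  also have "\<dots> = ennreal ?c * (\<integral>\<^sup>+\<omega>. indicator (stays F t) \<omega> * ennreal (exp (\<theta> * f (X t \<omega>))) \<partial>M)"
    by (rule nn_integral_cmult[OF meas])
  also have "\<dots> \<le> ennreal ?c * ennreal (exp (\<theta> * transition_op f t x0 + q * (\<theta> * B)\<^sup>2 / (2 * \<rho>)))"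
    by (intro mult_left_mono nn_integral_exp_stays_le[OF f F \<rho> \<theta> B t rate q contr]) auto
  also have "\<dots> = ennreal (exp (q * (\<theta> * B)\<^sup>2 / (2 * \<rho>) - \<theta> * m))"
    by (simp add: ennreal_mult'[symmetric] exp_add[symmetric] algebra_simps)
  finally show ?thesis by simp
qed

text \<open>Passes from finite subsets to \<open>S0\<close>, with a bound \<open>c\<close> common to
  all of them. A path has finite range before \<open>t\<close>, so the event for \<open>S0\<close>
  is the increasing union of the events for the initial segments of an enumeration.\<close>

lemma prob_stays_le:
  assumes A: "A \<in> sets M" and S0: "S0 \<subseteq> S" "S0 \<noteq> {}"
    and fin: "\<And>F. finite F \<Longrightarrow> F \<subseteq> S0 \<Longrightarrow> prob (A \<inter> stays F t) \<le> c"
  shows "prob (A \<inter> stays S0 t) \<le> c"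
proof -
  define F where "F n = from_nat_into S0 ` {..n}" for n :: nat
  have cS0: "countable S0" using S0(1) countable_S by (rule countable_subset)
  have F: "finite (F n)" "F n \<subseteq> S0" for n
    using from_nat_into[OF S0(2)] by (auto simp: F_def)
  have F_mono: "F k \<subseteq> F n" if "k \<le> n" for k n using that by (auto simp: F_def)
  have cover: "\<exists>n. G \<subseteq> F n" if "finite G" "G \<subseteq> S0" for G
    using that
  proof (induction G rule: finite_induct)
    case (insert x G)
    then obtain n where "G \<subseteq> F n" by auto
    moreover have "x \<in> F (to_nat_on S0 x)"
      using insert.prems cS0 by (auto simp: F_def intro!: image_eqI[of _ _ "to_nat_on S0 x"])
    ultimately have "insert x G \<subseteq> F (max n (to_nat_on S0 x))"
      using F_mono[of n "max n (to_nat_on S0 x)"] F_mono[of "to_nat_on S0 x" "max n (to_nat_on S0 x)"] by auto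
    then show ?case by blast
  qed auto
  have "stays S0 t = (\<Union>n. stays (F n) t)"
  proof (intro subset_antisym subsetI)
    fix \<omega> assume \<omega>: "\<omega> \<in> stays S0 t"
    then have sp: "\<omega> \<in> space M" by (simp add: stays_def)
    have "finite ((\<lambda>s. X s \<omega>) ` {0..t})"
      using X_right[OF sp] X_left[OF sp] by (rule finite_range_step_path)
    then have "finite ((\<lambda>s. X s \<omega>) ` {0..<t})" by (rule finite_subset[rotated]) auto
    moreover have "(\<lambda>s. X s \<omega>) ` {0..<t} \<subseteq> S0" using \<omega> by (auto simp: stays_def)
    ultimately obtain n where "(\<lambda>s. X s \<omega>) ` {0..<t} \<subseteq> F n" using cover by blast
    then have "\<omega> \<in> stays (F n) t" using sp by (auto simp: stays_def)
    then show "\<omega> \<in> (\<Union>n. stays (F n) t)" by blast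
  next
    fix \<omega> assume "\<omega> \<in> (\<Union>n. stays (F n) t)"
    then show "\<omega> \<in> stays S0 t" using F(2) by (fastforce simp: stays_def)
  qed
  then have "A \<inter> stays S0 t = (\<Union>n. A \<inter> stays (F n) t)" by blast
  moreover have "(\<lambda>n. prob (A \<inter> stays (F n) t)) \<longlonglongrightarrow> prob (\<Union>n. A \<inter> stays (F n) t)"
  proof (rule finite_Lim_measure_incseq)
    show "range (\<lambda>n. A \<inter> stays (F n) t) \<subseteq> sets M" using A sets_stays by blast
    show "incseq (\<lambda>n. A \<inter> stays (F n) t)"
      using F_mono by (fastforce simp: incseq_def stays_def)
  qed
  ultimately show ?thesis
    using LIMSEQ_le_const2[of "\<lambda>n. prob (A \<inter> stays (F n) t)" "prob (A \<inter> stays S0 t)" c] fin[OF F] by auto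
qed

lemma prob_deviation_bounded_le:
  assumes f: "\<And>y. \<bar>f y\<bar> \<le> C" and S0: "S0 \<subseteq> S" "S0 \<noteq> {}" and \<rho>: "0 < \<rho>"
    and B: "0 < B" and t: "0 < t" "t \<le> T" and m: "0 < m"
    and rate: "\<And>x. x \<in> S0 \<Longrightarrow> (\<Sum>\<^sub>\<infinity>y\<in>nbhd S Q x. Q x y) \<le> q" and q: "0 \<le> q"
    and contr: "\<And>x z s. x \<in> S0 \<Longrightarrow> z \<in> nbhd S Q x \<Longrightarrow> 0 \<le> s \<Longrightarrow> s \<le> T \<Longrightarrow>
      \<bar>transition_op f s z - transition_op f s x\<bar> \<le> B * exp (- \<rho> * s)"
  shows "prob ({\<omega> \<in> space M. transition_op f t x0 + m \<le> f (X t \<omega>)} \<inter> stays S0 t)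
    \<le> exp (- (m\<^sup>2 / (2 * q * B\<^sup>2 / \<rho> + 4 * B * m / 3)))"
proof (rule prob_stays_le[OF _ S0])
  show "{\<omega> \<in> space M. transition_op f t x0 + m \<le> f (X t \<omega>)} \<in> sets M"
    using t by (intro sets_X) auto
  fix F assume F: "finite F" "F \<subseteq> S0"
  \<comment> \<open>The exponent to be minimised is \<open>V * \<theta>^2 - \<theta> * m\<close>.
    Enlarging \<open>V\<close> to \<open>c\<close> before minimising gives
    \<open>\<theta> = m / (2 * c)\<close> and the value \<open>- m^2 / (4 * c)\<close>; the added
    \<open>B * m / 3\<close> is exactly what ensures \<open>\<theta> * B \<le> 3/2\<close>.\<close>
  define V where "V = q * B\<^sup>2 / (2 * \<rho>)"
  define c where "c = V + B * m / 3"
  define \<theta> where "\<theta> = m / (2 * c)"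
  have V: "0 \<le> V" using q \<rho> by (simp add: V_def)
  have c: "0 < c" using V B m by (simp add: c_def add_nonneg_pos)
  have \<theta>: "0 \<le> \<theta>" using m c by (simp add: \<theta>_def)
  have "\<theta> * B = B * m / (2 * c)" by (simp add: \<theta>_def)
  also have "\<dots> \<le> 3/2"
    using V c by (simp add: pos_divide_le_eq) (simp add: c_def)
  finally have \<theta>B: "\<theta> * B \<le> 3/2" .
  have "prob ({\<omega> \<in> space M. transition_op f t x0 + m \<le> f (X t \<omega>)} \<inter> stays F t)
    \<le> exp (q * (\<theta> * B)\<^sup>2 / (2 * \<rho>) - \<theta> * m)"
    using F S0 B by (intro prob_deviation_stays_finite_le[OF f _ _ \<rho> \<theta> \<theta>B _ t rate q contr]) auto
  also have "q * (\<theta> * B)\<^sup>2 / (2 * \<rho>) - \<theta> * m = V * \<theta>\<^sup>2 - \<theta> * m"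
    by (simp add: V_def power_mult_distrib)
  also have "V * \<theta>\<^sup>2 - \<theta> * m \<le> c * \<theta>\<^sup>2 - \<theta> * m"
    using B m by (intro diff_right_mono mult_right_mono) (auto simp: c_def)
  also have "c * \<theta>\<^sup>2 - \<theta> * m = - (m\<^sup>2 / (4 * c))"
    using c by (simp add: \<theta>_def field_simps power2_eq_square)
  also have "4 * c = 2 * q * B\<^sup>2 / \<rho> + 4 * B * m / 3"
    by (simp add: c_def V_def)
  finally show "prob ({\<omega> \<in> space M. transition_op f t x0 + m \<le> f (X t \<omega>)} \<inter> stays F t)
    \<le> exp (- (m\<^sup>2 / (2 * q * B\<^sup>2 / \<rho> + 4 * B * m / 3)))" by simp
qed

text \<open>Removes boundedness. The means of the truncations converge by dominated convergence, and
  a truncation differs from \<open>f\<close> only on an event of vanishing probability. A slack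
  \<delta> taken from \<open>m\<close> absorbs the error in the mean and is then sent to 0.\<close>

lemma prob_deviation_le:
  assumes int: "integrable M (\<lambda>\<omega>. f (X t \<omega>))" and S0: "S0 \<subseteq> S" "S0 \<noteq> {}" and \<rho>: "0 < \<rho>"
    and B: "0 < B" and t: "0 < t" "t \<le> T" and m: "0 < m"
    and rate: "\<And>x. x \<in> S0 \<Longrightarrow> (\<Sum>\<^sub>\<infinity>y\<in>nbhd S Q x. Q x y) \<le> q" and q: "0 \<le> q"
    and contr: "\<And>k x z s. x \<in> S0 \<Longrightarrow> z \<in> nbhd S Q x \<Longrightarrow> 0 \<le> s \<Longrightarrow> s \<le> T \<Longrightarrow>
      \<bar>transition_op (\<lambda>y. truncate k (f y)) s z - transition_op (\<lambda>y. truncate k (f y)) s x\<bar> \<le> B * exp (- \<rho> * s)"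
  shows "prob ({\<omega> \<in> space M. expectation (\<lambda>\<omega>. f (X t \<omega>)) + m \<le> f (X t \<omega>)} \<inter> stays S0 t)
    \<le> exp (- (m\<^sup>2 / (2 * q * B\<^sup>2 / \<rho> + 4 * B * m / 3)))" (is "prob ?E \<le> ?bound m")
proof -
  define e where "e = expectation (\<lambda>\<omega>. f (X t \<omega>))"
  define ek where "ek k = transition_op (\<lambda>y. truncate k (f y)) t x0" for k
  have t0: "0 \<le> t" using t by simp
  have trunc_bound: "\<bar>truncate k r\<bar> \<le> real k" for k r by (auto simp: truncate_def)
  have trunc_abs: "\<bar>truncate k r\<bar> \<le> \<bar>r\<bar>" for k r by (auto simp: truncate_def)
  have trunc_eq: "truncate k r = r" if "\<bar>r\<bar> \<le> real k" for k r
    using that by (auto simp: truncate_def)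
  have large: "\<forall>\<^sub>F k in sequentially. \<bar>r\<bar> \<le> real k" for r :: real
    using eventually_ge_at_top[of "nat \<lceil>\<bar>r\<bar>\<rceil>"] by eventually_elim linarith
  have ek_lim: "ek \<longlonglongrightarrow> e"
  proof -
    have "(\<lambda>k. expectation (\<lambda>\<omega>. truncate k (f (X t \<omega>)))) \<longlonglongrightarrow> e"
      unfolding e_def
    proof (rule integral_dominated_convergence[where w="\<lambda>\<omega>. \<bar>f (X t \<omega>)\<bar>"])
      show "(\<lambda>\<omega>. truncate k (f (X t \<omega>))) \<in> borel_measurable M" for k
        by (rule borel_measurable_X[OF t0])
      show "integrable M (\<lambda>\<omega>. \<bar>f (X t \<omega>)\<bar>)" using int by (rule integrable_abs)
      show "AE \<omega> in M. (\<lambda>k. truncate k (f (X t \<omega>))) \<longlonglongrightarrow> f (X t \<omega>)"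
        using large trunc_eq by (intro AE_I2 tendsto_eventually) (fast elim: eventually_mono)
    qed (use trunc_abs borel_measurable_X[OF t0] in auto)
    moreover have "expectation (\<lambda>\<omega>. truncate k (f (X t \<omega>))) = ek k" for k
      unfolding ek_def by (rule expectation_X[OF t0, where f="\<lambda>y. truncate k (f y)"])
    ultimately show ?thesis by simp
  qed
  define T' where "T' k = {\<omega> \<in> space M. real k < \<bar>f (X t \<omega>)\<bar>}" for k
  have T': "T' k \<in> sets M" for k unfolding T'_def by (rule sets_X[OF t0])
  have T'_lim: "(\<lambda>k. prob (T' k)) \<longlonglongrightarrow> 0"
  proof -
    have "(\<lambda>k. prob (T' k)) \<longlonglongrightarrow> prob (\<Inter>k. T' k)"
      using T' by (intro finite_Lim_measure_decseq) (auto simp: decseq_def T'_def)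
    moreover have "(\<Inter>k. T' k) = {}"
    proof -
      have "\<exists>k. \<not> real k < \<bar>r\<bar>" for r :: real
        using real_arch_simple[of "\<bar>r\<bar>"] by (auto simp: not_less)
      then show ?thesis by (auto simp: T'_def)
    qed
    ultimately show ?thesis by simp
  qed
  have shrink: "prob ?E \<le> ?bound (m - \<delta>)" if \<delta>: "0 < \<delta>" "\<delta> < m" for \<delta>
  proof -
    have "\<forall>\<^sub>F k in sequentially. ek k < e + \<delta>"
      using ek_lim \<delta> by (intro order_tendstoD) auto
    then have "\<forall>\<^sub>F k in sequentially. prob ?E \<le> ?bound (m - \<delta>) + prob (T' k)"
    proof eventually_elim
      fix k assume k: "ek k < e + \<delta>"
      let ?G = "{\<omega> \<in> space M. ek k + (m - \<delta>) \<le> truncate k (f (X t \<omega>))} \<inter> stays S0 t"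
      have G: "?G \<in> sets M" by (intro sets.Int sets_X[OF t0] sets_stays)
      \<comment> \<open>Off \<open>T' k\<close> truncation changes nothing, and
        \<open>ek k < e + \<delta>\<close> turns a deviation by \<open>m\<close> from the true mean
        into one by \<open>m - \<delta>\<close> from the truncated mean.\<close>
      have "?E \<subseteq> ?G \<union> T' k"
      proof
        fix \<omega> assume \<omega>: "\<omega> \<in> ?E"
        show "\<omega> \<in> ?G \<union> T' k"
        proof (cases "\<bar>f (X t \<omega>)\<bar> \<le> real k")
          case True
          then show ?thesis using \<omega> k trunc_eq[OF True] by (auto simp: e_def)
        qed (use \<omega> in \<open>auto simp: T'_def\<close>)
      qed
      then have "prob ?E \<le> prob (?G \<union> T' k)"
        using G T' by (intro finite_measure_mono sets.Un)
      also have "\<dots> \<le> prob ?G + prob (T' k)"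
        by (rule measure_Un_le[OF G T'])
      also have "prob ?G \<le> ?bound (m - \<delta>)"
        unfolding ek_def using \<delta>
        by (intro prob_deviation_bounded_le[OF trunc_bound S0 \<rho> B t _ rate q contr]) auto
      finally show "prob ?E \<le> ?bound (m - \<delta>) + prob (T' k)" by simp
    qed
    moreover have "(\<lambda>k. ?bound (m - \<delta>) + prob (T' k)) \<longlonglongrightarrow> ?bound (m - \<delta>) + 0"
      by (intro tendsto_intros T'_lim)
    ultimately show ?thesis
      using tendsto_lowerbound[OF _ _ trivial_limit_sequentially] by fastforce
  qed
  \<comment> \<open>At \<delta> = 0 the denominator of the bound must not vanish, so that the bound
    is continuous there.\<close>
  have "2 * q * B\<^sup>2 / \<rho> + 4 * B * m / 3 \<noteq> 0"
    using q \<rho> B m by (intro less_imp_neq[symmetric] add_nonneg_pos) auto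
  then have "((\<lambda>\<delta>. ?bound (m - \<delta>)) \<longlongrightarrow> ?bound (m - 0)) (at_right 0)"
    by (intro tendsto_intros) auto
  moreover have "\<forall>\<^sub>F \<delta> in at_right 0. prob ?E \<le> ?bound (m - \<delta>)"
    unfolding eventually_at_right_field using m shrink by blast
  ultimately show ?thesis
    using tendsto_lowerbound[of "\<lambda>\<delta>. ?bound (m - \<delta>)" "?bound (m - 0)" "at_right 0" "prob ?E"] by simp
qed

end

section \<open>Contraction of the semigroup from the coupling\<close>

context Q_process begin

text \<open>Both chains live on the same space, so the difference of the two means is the mean of
  one difference, which the Lipschitz condition bounds by the mean distance.\<close>

lemma coupling_contraction:
  assumes Y: "markov_chain_from S P N Y1 x" "markov_chain_from S P N Y2 y" and xy: "x \<in> S" "y \<in> S"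
    and s: "0 \<le> s" and L: "0 < L"
    and f: "\<And>y. \<bar>f y\<bar> \<le> C" and lip: "\<And>u v. u \<in> S \<Longrightarrow> v \<in> S \<Longrightarrow> \<bar>f u - f v\<bar> \<le> L * d u v"
    and dist: "(\<integral>\<^sup>+\<omega>. ennreal (d (Y1 s \<omega>) (Y2 s \<omega>)) \<partial>N) \<le> ennreal b" and b: "0 \<le> b"
  shows "\<bar>transition_op f s y - transition_op f s x\<bar> \<le> L * b"
proof -
  interpret c1: Q_chain S Q P N Y1 x using Y xy by unfold_locales
  interpret c2: Q_chain S Q P N Y2 y using Y xy by unfold_locales
  have int: "integrable N (\<lambda>\<omega>. f (Y1 s \<omega>))" "integrable N (\<lambda>\<omega>. f (Y2 s \<omega>))"
    using f by (auto intro!: c1.integrable_const_bound[where B=C] c1.borel_measurable_X[OF s] c2.borel_measurable_X[OF s])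
  \<comment> \<open>Division by \<open>L\<close> makes the comparison with \<open>d\<close>
    pointwise, so the nonnegative integral of \<open>d\<close> can be used exactly as it is
    given.\<close>
  let ?g = "\<lambda>\<omega>. \<bar>f (Y2 s \<omega>) - f (Y1 s \<omega>)\<bar> / L"
  have int_g: "integrable N ?g" using int by auto
  have "ennreal (c1.expectation ?g) = (\<integral>\<^sup>+\<omega>. ennreal (?g \<omega>) \<partial>N)"
    using L by (intro nn_integral_eq_integral[symmetric] int_g) auto
  also have "\<dots> \<le> (\<integral>\<^sup>+\<omega>. ennreal (d (Y1 s \<omega>) (Y2 s \<omega>)) \<partial>N)"
  proof (intro nn_integral_mono ennreal_leI)
    fix \<omega> assume "\<omega> \<in> space N"
    then have "\<bar>f (Y1 s \<omega>) - f (Y2 s \<omega>)\<bar> \<le> L * d (Y1 s \<omega>) (Y2 s \<omega>)"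
      using s by (intro lip c1.X_in_S c2.X_in_S)
    then show "?g \<omega> \<le> d (Y1 s \<omega>) (Y2 s \<omega>)"
      using L by (simp add: abs_minus_commute pos_divide_le_eq mult.commute)
  qed
  also note dist
  finally have "c1.expectation ?g \<le> b" using b by simp
  then have E: "c1.expectation (\<lambda>\<omega>. \<bar>f (Y2 s \<omega>) - f (Y1 s \<omega>)\<bar>) \<le> L * b"
    using L by (simp add: pos_divide_le_eq mult.commute)
  have "transition_op f s y - transition_op f s x = c1.expectation (\<lambda>\<omega>. f (Y2 s \<omega>) - f (Y1 s \<omega>))"
    using int by (simp add: c1.expectation_X[OF s, symmetric] c2.expectation_X[OF s, symmetric])
  also have "\<bar>\<dots>\<bar> \<le> c1.expectation (\<lambda>\<omega>. \<bar>f (Y2 s \<omega>) - f (Y1 s \<omega>)\<bar>)"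
    by (rule integral_abs_bound)
  finally show ?thesis using E by linarith
qed

end

section \<open>The two-sided bound for Lipschitz functions\<close>

theorem theorem3p3:
  fixes S S0 :: "'a set" and Q :: "'a \<Rightarrow> 'a \<Rightarrow> real"
    and P :: "real \<Rightarrow> 'a \<Rightarrow> 'a \<Rightarrow> real"
    and d :: "'a \<Rightarrow> 'a \<Rightarrow> real"
    and M :: "'w measure" and X :: "real \<Rightarrow> 'w \<Rightarrow> 'a"
    and Mc :: "'a \<Rightarrow> 'a \<Rightarrow> 'v measure"
    and X1 X2 :: "'a \<Rightarrow> 'a \<Rightarrow> real \<Rightarrow> 'v \<Rightarrow> 'a"
    and f :: "'a \<Rightarrow> real" and D \<rho> t0 L m t :: real and x0 :: 'a
  assumes S: "countable S" and S0: "S0 \<subseteq> S"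
    and Q: "Q_matrix S Q" "conservative S Q" and P: "Q_function S Q P"
    and d: "metric_on S d"
    and q0_fin: "bdd_above ((\<lambda>x. \<Sum>\<^sub>\<infinity>y\<in>nbhd S Q x. Q x y) ` S0)"
    and pos: "D > 0" "\<rho> > 0" "t0 > 0"
    and coupling: "\<And>x y. x \<in> S0 \<Longrightarrow> y \<in> nbhd S Q x \<Longrightarrow>
        markov_chain_from S P (Mc x y) (X1 x y) x \<and>
        markov_chain_from S P (Mc x y) (X2 x y) y \<and>
        (\<forall>s. 0 \<le> s \<and> s \<le> t0 \<longrightarrow>
           (\<integral>\<^sup>+\<omega>. ennreal (d (X1 x y s \<omega>) (X2 x y s \<omega>)) \<partial>Mc x y) \<le> ennreal (D * exp (- \<rho> * s)))"
    and lip: "\<forall>x\<in>S. \<forall>x'\<in>S. \<bar>f x - f x'\<bar> \<le> L * d x x'"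
    and x0: "x0 \<in> S0" and X: "markov_chain_from S P M X x0"
    and t: "0 < t" "t \<le> t0" and m: "m > 0"
    and integ: "integrable M (\<lambda>\<omega>. f (X t \<omega>))"
  shows "measure M {\<omega> \<in> space M.
            \<bar>f (X t \<omega>) - (\<integral>\<omega>'. f (X t \<omega>') \<partial>M)\<bar> \<ge> m \<and> (\<forall>s. 0 \<le> s \<and> s < t \<longrightarrow> X s \<omega> \<in> S0)}
         \<le> 2 * exp (- (m\<^sup>2 / (2 * q0 S S0 Q * L\<^sup>2 * D\<^sup>2 / \<rho> + 4 * L * D * m / 3)))"
proof -
  have x0S: "x0 \<in> S" using x0 S0 by auto
  interpret Q_chain S Q P M X x0
    using S Q P X x0S by unfold_locales
  have t0': "0 \<le> t" using t by simp
  define A where "A = {\<omega> \<in> space M. m \<le> \<bar>f (X t \<omega>) - expectation (\<lambda>\<omega>. f (X t \<omega>))\<bar>} \<inter> stays S0 t"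
  have A_eq: "{\<omega> \<in> space M.
            \<bar>f (X t \<omega>) - (\<integral>\<omega>'. f (X t \<omega>') \<partial>M)\<bar> \<ge> m \<and> (\<forall>s. 0 \<le> s \<and> s < t \<longrightarrow> X s \<omega> \<in> S0)} = A"
    by (auto simp: A_def stays_def)
  let ?q = "q0 S S0 Q"
  have rate: "(\<Sum>\<^sub>\<infinity>y\<in>nbhd S Q x. Q x y) \<le> ?q" if "x \<in> S0" for x
    unfolding q0_def using that q0_fin by (rule cSUP_upper)
  \<comment> \<open>The empty set of jumps bounds the total rate at \<open>x0\<close> from below by
    0.\<close>
  have q: "0 \<le> ?q"
    using rate[OF x0] sum_rates_le[OF x0S, of "{}"] by simp
  show ?thesis
  proof (cases "0 < L")
    \<comment> \<open>If \<open>L \<le> 0\<close>, then \<open>f\<close> is constant on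
      \<open>S\<close> and the deviation event is empty; the right-hand side is positive in any
      case.\<close>
    case False
    have "f (X t \<omega>) = f x0" if "\<omega> \<in> space M" for \<omega>
    proof -
      have "L * d (X t \<omega>) x0 \<le> 0"
        using False d x0S X_in_S[OF that t0'] by (intro mult_nonpos_nonneg) (auto simp: metric_on_def)
      then show ?thesis using lip x0S X_in_S[OF that t0'] by fastforce
    qed
    then have "A = {}"
      using m by (auto simp: A_def prob_space cong: Bochner_Integration.integral_cong)
    then show ?thesis unfolding A_eq by simp
  next
    case True
    \<comment> \<open>The bound on a jump of \<open>g\<close> when no time remains, which is its
      largest value.\<close>
    let ?B = "L * D"
    let ?bound = "exp (- (m\<^sup>2 / (2 * ?q * ?B\<^sup>2 / \<rho> + 4 * ?B * m / 3)))"
    \<comment> \<open>Stated for every \<open>g\<close> with the Lipschitz bound of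
      \<open>f\<close>, since it is applied to both \<open>f\<close> and its negative.\<close>
    have contr: "\<bar>transition_op (\<lambda>y. truncate k (g y)) s z - transition_op (\<lambda>y. truncate k (g y)) s x\<bar>
          \<le> ?B * exp (- \<rho> * s)"
      if x: "x \<in> S0" and z: "z \<in> nbhd S Q x" and s: "0 \<le> s" "s \<le> t0"
        and g: "\<And>u v. u \<in> S \<Longrightarrow> v \<in> S \<Longrightarrow> \<bar>g u - g v\<bar> \<le> L * d u v" for g k x z s
    proof -
      have "\<bar>transition_op (\<lambda>y. truncate k (g y)) s z - transition_op (\<lambda>y. truncate k (g y)) s x\<bar>
          \<le> L * (D * exp (- \<rho> * s))"
      proof (rule coupling_contraction[where N="Mc x z" and ?Y1.0="X1 x z" and ?Y2.0="X2 x z" and C="real k" and d=d])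
        \<comment> \<open>Clamping is 1-Lipschitz, so truncation preserves the Lipschitz
          bound.\<close>
        show "\<bar>truncate k (g u) - truncate k (g v)\<bar> \<le> L * d u v" if "u \<in> S" "v \<in> S" for u v
          using g[OF that] by (auto simp: truncate_def)
        show "\<bar>truncate k (g y)\<bar> \<le> real k" for y by (auto simp: truncate_def)
        show "x \<in> S" "z \<in> S" using x z S0 by (auto simp: nbhd_def)
        show "0 \<le> D * exp (- \<rho> * s)" using pos by simp
      qed (use coupling[OF x z] s True in auto)
      then show ?thesis by (simp add: mult.assoc)
    qed
    define U where "U g = {\<omega> \<in> space M. expectation (\<lambda>\<omega>. g (X t \<omega>)) + m \<le> g (X t \<omega>)} \<inter> stays S0 t"
      for g :: "'a \<Rightarrow> real"
    have U: "U g \<in> sets M" for g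
      unfolding U_def by (intro sets.Int sets_X[OF t0'] sets_stays)
    have tail: "prob (U g) \<le> ?bound" if "integrable M (\<lambda>\<omega>. g (X t \<omega>))"
      and "\<And>u v. u \<in> S \<Longrightarrow> v \<in> S \<Longrightarrow> \<bar>g u - g v\<bar> \<le> L * d u v" for g
      unfolding U_def using x0 pos True
      by (intro prob_deviation_le[OF that(1) S0 _ pos(2) _ t m rate q contr[OF _ _ _ _ that(2)]]) auto
    \<comment> \<open>The lower tail is the upper tail of \<open>- f\<close>; the two together
      account for the factor 2.\<close>
    have "A \<subseteq> U f \<union> U (\<lambda>y. - f y)"
      by (auto simp: A_def U_def)
    then have "prob A \<le> prob (U f \<union> U (\<lambda>y. - f y))"
      by (intro finite_measure_mono sets.Un U)
    also have "\<dots> \<le> prob (U f) + prob (U (\<lambda>y. - f y))"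
      by (rule measure_Un_le[OF U U])
    also have "\<dots> \<le> ?bound + ?bound"
    proof (intro add_mono tail)
      show "\<bar>- f u - - f v\<bar> \<le> L * d u v" if "u \<in> S" "v \<in> S" for u v
        using lip that by (simp add: abs_minus_commute)
    qed (use lip integ in auto)
    finally show ?thesis
      unfolding A_eq by (simp add: power_mult_distrib mult.assoc)
  qed
qed

end
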